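(* Let $\phi$ be an LTL formula over $P=I\uplus O$ with weight function $w_P:\mathrm{Lit}(P)\to\mathbb{Z}$. Let $\langle G_\phi,w,p\rangle$ be the associated energy parity game (as in the context), with $|S|$ states, $d$ priorities and largest absolute edge weight $W$. Let $\mathcal A$ be a universal co-Büchi automaton with $n$ states such that $L_{\mathrm{ucb}}(\mathcal A)=[\![\phi]\!]$. Let $\mathbb K=4\cdot n\cdot|S|^2\cdot d\cdot W$ and $\mathbb C=\mathbb K\cdot W$. Then $\phi$ is E-realizable if and only if there exists a Moore machine $\mathcal M$ such that $L(\mathcal M)\subseteq L_{\mathrm{ucb},\mathbb K}(\mathcal A^w,\mathbb C)$.
   Context: $\Sigma_P=2^P$, $\Sigma_I=2^I$, $\Sigma_O=2^O$. $w_P$ extends to $\Sigma_I$ by $w_P(i)=\sum_{p\in i}w_P(p)+\sum_{p\in I\setminus i}w_P(\neg p)$, similarly to $\Sigma_O$, and $w_P(o\cup i)=w_P(o)+w_P(i)$. Game: Player $O$ chooses $o_0\in\Sigma_O$, Player $I$ responds $i_0\in\Sigma_I$, then $o_1,i_1,\dots$; strategies $\lambda_O:(\Sigma_O\Sigma_I)^*\to\Sigma_O$, $\lambda_I:(\Sigma_O\Sigma_I)^*\Sigma_O\to\Sigma_I$. $\phi$ is E-realizable if there exist $\lambda_O$ and $c_0\in\mathbb{N}$ such that for all $\lambda_I$, $u=\mathsf{Outcome}(\lambda_O,\lambda_I)\models\phi$ and $c_0+\sum_{k<n}w_P(\sigma_k)\ge0$ for all $n$. $G_\phi$ is built from a deterministic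 complete parity automaton $(\Sigma_P,Q,q_0,\delta,p)$ recognizing $[\![\phi]\!]$ (acceptance: minimal priority visited infinitely often is even): Player-1 states $Q\times\Sigma_I$, Player-2 states $Q\times\Sigma_O$ (reachable ones), initial $(q_0,j_0)$ for fixed $j_0\in\Sigma_I$; for $q'=\delta(q,o\cup i)$ edges $((q,j),(q,o))$ for all $j$ and $((q,o),(q',i))$; priority of $(q,x)$ is $p(q)$; edges ending in $(q,o)$ weigh $w_P(o)$, edges ending in $(q,i)$ weigh $w_P(i)$. A Moore machine $\mathcal M=(M,m_0,\alpha_U,\alpha_N)$: finite $M$, $m_0\in M$, $\alpha_U:M\times\Sigma_I\to M$, $\alpha_N:M\to\Sigma_O$; $L(\mathcal M)$ is the set of $(o_0\cup i_0)(o_1\cup i_1)\cdots$ with $o_0=\alpha_N(m_0)$, $o_k=\alpha_N(\alpha_U(m_0,i_0\cdots i_{k-1}))$. For an automaton $\mathcal A=(\Sigma_P,Q_{\mathcal A},q_{\mathcal A},\alpha,\delta)$ with $\delta:Q_{\mathcal A}\times\Sigma_P\to2^{Q_{\mathcal A}}$: $L_{\mathrm{ucb}}(\mathcal A)$ is the set of words all of whose runs visit $\alpha$ finitely often; for $K,c\in\mathbb{N}$, $L_{\mathrm{ucb},K}(\mathcal A^w,c)$ is the set of words $u=\sigma_0\sigma_1\cdots$ such that every run visits states of $\alpha$ at most $K$ times in total and $c+\sum_{k<n}w_P(\sigma_k)\ge0$ for all $n\ge0$.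
   Formalization: The formal theorem assumes W ≥ 1; for W = 0 one gets K = C = 0 and the claim fails, e.g. for φ = true with all weights 0 and an automaton whose initial state lies in α and moves to a sink outside α. *)

theory Defs
  imports Main
begin

type_synonym 'a word = "nat \<Rightarrow> 'a set"

definition words :: "'a set \<Rightarrow> 'a word set" where
  "words P = {u. \<forall>k. u k \<subseteq> P}"


datatype (atoms: 'a) ltl =
    LTrue
  | LAtom 'a
  | LNot "'a ltl"
  | LOr "'a ltl" "'a ltl"
  | LNext "'a ltl"
  | LUntil "'a ltl" "'a ltl"

primrec ltl_sat :: "'a word \<Rightarrow> 'a ltl \<Rightarrow> bool" where
  "ltl_sat u LTrue = True"
| "ltl_sat u (LAtom a) = (a \<in> u 0)"
| "ltl_sat u (LNot f) = (\<not> ltl_sat u f)"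
| "ltl_sat u (LOr f g) = (ltl_sat u f \<or> ltl_sat u g)"
| "ltl_sat u (LNext f) = ltl_sat (\<lambda>k. u (Suc k)) f"
| "ltl_sat u (LUntil f g) =
     (\<exists>n. ltl_sat (\<lambda>k. u (n + k)) g \<and> (\<forall>m<n. ltl_sat (\<lambda>k. u (m + k)) f))"

definition ltl_lang :: "'a set \<Rightarrow> 'a ltl \<Rightarrow> 'a word set" where
  "ltl_lang P f = {u \<in> words P. ltl_sat u f}"


datatype 'a literal = Pos 'a | Neg 'a

definition set_weight :: "('a literal \<Rightarrow> int) \<Rightarrow> 'a set \<Rightarrow> 'a set \<Rightarrow> int" where
  "set_weight w X x = (\<Sum>p\<in>x. w (Pos p)) + (\<Sum>p\<in>X - x. w (Neg p))"

definition letter_weight :: "('a literal \<Rightarrow> int) \<Rightarrow> 'a set \<Rightarrow> 'a set \<Rightarrow> 'a set \<Rightarrow> int" where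
  "letter_weight w In Out s = set_weight w Out (s \<inter> Out) + set_weight w In (s \<inter> In)"

definition energy_ok ::
  "('a literal \<Rightarrow> int) \<Rightarrow> 'a set \<Rightarrow> 'a set \<Rightarrow> nat \<Rightarrow> 'a word \<Rightarrow> bool" where
  "energy_ok w In Out c u \<longleftrightarrow> (\<forall>n. int c + (\<Sum>k<n. letter_weight w In Out (u k)) \<ge> 0)"


text \<open>A history in \<open>(\<Sigma>\<^sub>O \<Sigma>\<^sub>I)\<^sup>*\<close> is the list of its rounds \<open>(o, i)\<close>.\<close>

type_synonym 'a history = "('a set \<times> 'a set) list"

definition histories :: "'a set \<Rightarrow> 'a set \<Rightarrow> 'a history set" where
  "histories In Out = lists (Pow Out \<times> Pow In)"

definition strategies_O :: "'a set \<Rightarrow> 'a set \<Rightarrow> ('a history \<Rightarrow> 'a set) set" where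
  "strategies_O In Out = {f. \<forall>h \<in> histories In Out. f h \<in> Pow Out}"

definition strategies_I :: "'a set \<Rightarrow> 'a set \<Rightarrow> ('a history \<Rightarrow> 'a set \<Rightarrow> 'a set) set" where
  "strategies_I In Out = {g. \<forall>h \<in> histories In Out. \<forall>x \<in> Pow Out. g h x \<in> Pow In}"

primrec play_prefix ::
  "('a history \<Rightarrow> 'a set) \<Rightarrow> ('a history \<Rightarrow> 'a set \<Rightarrow> 'a set) \<Rightarrow> nat \<Rightarrow> 'a history" where
  "play_prefix f g 0 = []"
| "play_prefix f g (Suc n) =
     (let h = play_prefix f g n; x = f h in h @ [(x, g h x)])"

definition outcome ::
  "('a history \<Rightarrow> 'a set) \<Rightarrow> ('a history \<Rightarrow> 'a set \<Rightarrow> 'a set) \<Rightarrow> 'a word" where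
  "outcome f g k = (let h = play_prefix f g k; x = f h in x \<union> g h x)"

definition E_realizable ::
  "'a set \<Rightarrow> 'a set \<Rightarrow> ('a literal \<Rightarrow> int) \<Rightarrow> 'a ltl \<Rightarrow> bool" where
  "E_realizable In Out w \<phi> \<longleftrightarrow>
     (\<exists>f \<in> strategies_O In Out. \<exists>c0::nat. \<forall>g \<in> strategies_I In Out.
        ltl_sat (outcome f g) \<phi> \<and> energy_ok w In Out c0 (outcome f g))"


record ('q, 'a) dpa =
  dpa_states :: "'q set"
  dpa_init :: 'q
  dpa_trans :: "'q \<Rightarrow> 'a set \<Rightarrow> 'q"
  dpa_prio :: "'q \<Rightarrow> nat"

definition is_dpa :: "'a set \<Rightarrow> ('q, 'a) dpa \<Rightarrow> bool" where
  "is_dpa P D \<longleftrightarrow>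
     finite (dpa_states D) \<and> dpa_init D \<in> dpa_states D \<and>
     (\<forall>q \<in> dpa_states D. \<forall>s \<in> Pow P. dpa_trans D q s \<in> dpa_states D)"

primrec dpa_run :: "('q, 'a) dpa \<Rightarrow> 'a word \<Rightarrow> nat \<Rightarrow> 'q" where
  "dpa_run D u 0 = dpa_init D"
| "dpa_run D u (Suc k) = dpa_trans D (dpa_run D u k) (u k)"

definition dpa_lang :: "'a set \<Rightarrow> ('q, 'a) dpa \<Rightarrow> 'a word set" where
  "dpa_lang P D =
     {u \<in> words P. even (Min {c. infinite {k. dpa_prio D (dpa_run D u k) = c}})}"


record 's energy_parity_game =
  player1 :: "'s set"
  player2 :: "'s set"
  game_init :: 's
  edges :: "('s \<times> 's) set"
  weight :: "'s \<times> 's \<Rightarrow> int"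
  prio :: "'s \<Rightarrow> nat"

definition game_states :: "'s energy_parity_game \<Rightarrow> 's set" where
  "game_states G = player1 G \<union> player2 G"

definition num_priorities :: "'s energy_parity_game \<Rightarrow> nat" where
  "num_priorities G = card (prio G ` game_states G)"

definition max_weight :: "'s energy_parity_game \<Rightarrow> nat" where
  "max_weight G = Max ((\<lambda>e. nat \<bar>weight G e\<bar>) ` edges G)"

text \<open>The constructors tag the owner of a state: the empty set is a member of both
  \<open>\<Sigma>\<^sub>I\<close> and \<open>\<Sigma>\<^sub>O\<close>, so plain pairs would identify a Player-1 state with a Player-2 state.\<close>

datatype ('q, 'a) gstate = St1 'q "'a set" | St2 'q "'a set"

definition full_edges ::
  "'a set \<Rightarrow> 'a set \<Rightarrow> ('q, 'a) dpa \<Rightarrow> (('q, 'a) gstate \<times> ('q, 'a) gstate) set" where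
  "full_edges In Out D =
     {(St1 q j, St2 q x) | q j x. q \<in> dpa_states D \<and> j \<in> Pow In \<and> x \<in> Pow Out} \<union>
     {(St2 q x, St1 (dpa_trans D q (x \<union> i)) i) | q x i.
        q \<in> dpa_states D \<and> x \<in> Pow Out \<and> i \<in> Pow In}"

definition reachable_states ::
  "'a set \<Rightarrow> 'a set \<Rightarrow> ('q, 'a) dpa \<Rightarrow> 'a set \<Rightarrow> ('q, 'a) gstate set" where
  "reachable_states In Out D j0 = {s. (St1 (dpa_init D) j0, s) \<in> (full_edges In Out D)\<^sup>*}"

primrec gstate_weight ::
  "'a set \<Rightarrow> 'a set \<Rightarrow> ('a literal \<Rightarrow> int) \<Rightarrow> ('q, 'a) gstate \<Rightarrow> int" where
  "gstate_weight In Out w (St1 q i) = set_weight w In i"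
| "gstate_weight In Out w (St2 q x) = set_weight w Out x"

primrec gstate_prio :: "('q, 'a) dpa \<Rightarrow> ('q, 'a) gstate \<Rightarrow> nat" where
  "gstate_prio D (St1 q i) = dpa_prio D q"
| "gstate_prio D (St2 q x) = dpa_prio D q"

definition game_of ::
  "'a set \<Rightarrow> 'a set \<Rightarrow> ('a literal \<Rightarrow> int) \<Rightarrow> ('q, 'a) dpa \<Rightarrow> 'a set
    \<Rightarrow> ('q, 'a) gstate energy_parity_game" where
  "game_of In Out w D j0 =
     \<lparr>player1 = {St1 q i | q i. q \<in> dpa_states D \<and> i \<in> Pow In} \<inter> reachable_states In Out D j0,
      player2 = {St2 q x | q x. q \<in> dpa_states D \<and> x \<in> Pow Out} \<inter> reachable_states In Out D j0,
      game_init = St1 (dpa_init D) j0,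
      edges = full_edges In Out D \<inter>
        (reachable_states In Out D j0 \<times> reachable_states In Out D j0),
      weight = (\<lambda>(s, t). gstate_weight In Out w t),
      prio = gstate_prio D\<rparr>"


record ('m, 'a) moore =
  moore_states :: "'m set"
  moore_init :: 'm
  moore_trans :: "'m \<Rightarrow> 'a set \<Rightarrow> 'm"
  moore_out :: "'m \<Rightarrow> 'a set"

definition is_moore :: "'a set \<Rightarrow> 'a set \<Rightarrow> ('m, 'a) moore \<Rightarrow> bool" where
  "is_moore In Out M \<longleftrightarrow>
     finite (moore_states M) \<and> moore_init M \<in> moore_states M \<and>
     (\<forall>m \<in> moore_states M. \<forall>i \<in> Pow In. moore_trans M m i \<in> moore_states M) \<and>
     (\<forall>m \<in> moore_states M. moore_out M m \<in> Pow Out)"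

definition moore_lang :: "'a set \<Rightarrow> ('m, 'a) moore \<Rightarrow> 'a word set" where
  "moore_lang In M =
     {u. \<exists>i. (\<forall>k. i k \<in> Pow In) \<and>
        (\<forall>k. u k = moore_out M (foldl (moore_trans M) (moore_init M) (map i [0..<k])) \<union> i k)}"


record ('s, 'a) automaton =
  aut_states :: "'s set"
  aut_init :: 's
  aut_final :: "'s set"
  aut_trans :: "'s \<Rightarrow> 'a set \<Rightarrow> 's set"

definition is_automaton :: "'a set \<Rightarrow> ('s, 'a) automaton \<Rightarrow> bool" where
  "is_automaton P A \<longleftrightarrow>
     finite (aut_states A) \<and> aut_init A \<in> aut_states A \<and> aut_final A \<subseteq> aut_states A \<and>
     (\<forall>q \<in> aut_states A. \<forall>s \<in> Pow P. aut_trans A q s \<subseteq> aut_states A)"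

text \<open>Runs are infinite; a branch on which the transition function yields the empty set is
  not a run, hence imposes no condition under universal acceptance.\<close>

definition runs :: "('s, 'a) automaton \<Rightarrow> 'a word \<Rightarrow> (nat \<Rightarrow> 's) set" where
  "runs A u = {r. r 0 = aut_init A \<and> (\<forall>k. r (Suc k) \<in> aut_trans A (r k) (u k))}"

definition L_ucb :: "'a set \<Rightarrow> ('s, 'a) automaton \<Rightarrow> 'a word set" where
  "L_ucb P A = {u \<in> words P. \<forall>r \<in> runs A u. finite {k. r k \<in> aut_final A}}"

definition L_ucb_K ::
  "'a set \<Rightarrow> 'a set \<Rightarrow> ('a literal \<Rightarrow> int) \<Rightarrow> nat \<Rightarrow> ('s, 'a) automaton \<Rightarrow> nat \<Rightarrow> 'a word set" where
  "L_ucb_K In Out w K A c =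
     {u \<in> words (In \<union> Out).
        (\<forall>r \<in> runs A u. finite {k. r k \<in> aut_final A} \<and> card {k. r k \<in> aut_final A} \<le> K) \<and>
        energy_ok w In Out c u}"

end

theory Submission
  imports Defs "HOL-Library.Infinite_Set"
begin

text \<open>
  Merge the two moves of a round, so that the vertices of the game are the \<open>N\<close> Player-1 states and a
  round weighs at most \<open>B = 2 W\<close> in absolute value. On the set of vertices that Player 1 wins with
  some initial credit, the credit \<open>(N - 1) B\<close> suffices. Truncating the energy at \<open>2 N d B\<close> does not
  change the winner, by induction on the number of vertices. If the least priority \<open>m\<close> is even,
  Player 1 alternates between collecting energy with an arbitrary winning strategy and spending it: on
  the attractor of the vertices of priority \<open>m\<close> in order to visit \<open>m\<close>, elsewhere on the inductively
  given strategy for the complement of the attractor. If \<open>m\<close> is odd, there are vertices from which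
  Player 1 wins without ever visiting \<open>m\<close>, and she attracts the play to them. The truncated game is a
  finite parity game, hence won positionally, which yields a Moore machine with at most
  \<open>N (2 N d B + 1) \<le> 4 |S|\<^sup>2 d W\<close> states. A run of the automaton on one of its words that visits
  \<open>\<alpha>\<close> more than \<open>n\<close> times this number often would repeat a product state with a visit of \<open>\<alpha>\<close>
  in between, and pumping the loop would give a word of the machine outside \<open>L\<^sub>u\<^sub>c\<^sub>b\<close>.
\<close>

section \<open>Parity games and strategies with memory\<close>

text \<open>The obstacle is that a winning strategy of the unbounded game may save arbitrarily much
  energy before it visits good priorities, so no memory bound can be read off from it. Such a
  strategy is therefore followed only until its energy reaches a fixed level. If this never happens,
  the energy stays bounded and truncation does no harm; otherwise the saved amount pays for
  everything that comes next. All inductions run on arenas that Player 1 wins from every vertex;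
  other arenas are first cut down to her winning set. The cap is a budget. If the least priority is
  even, the complement of the attractor has lost that priority, so the cap it requires is smaller by
  at least \<open>2 N B\<close>, which covers the reserve for returning through the attractor. If it
  is odd, that priority may remain, and the reserve of \<open>a B\<close> for an attractor with
  \<open>a\<close> vertices is financed by the drop in the number of vertices. Truncation only
  discards energy, so a truncated play that stays nonnegative certifies the true energy; this makes
  the cap itself a sufficient initial credit.\<close>

definition parity :: "('n \<Rightarrow> nat) \<Rightarrow> (nat \<Rightarrow> 'n) \<Rightarrow> bool" where
  "parity p \<pi> \<longleftrightarrow> (\<exists>c. even c \<and> (\<forall>k. \<exists>j\<ge>k. p (\<pi> j) = c) \<and> (\<exists>k. \<forall>j\<ge>k. c \<le> p (\<pi> j)))"

lemma parity_suffix_iff: "parity p (\<lambda>k. \<pi> (m + k)) \<longleftrightarrow> parity p \<pi>"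
proof -
  have "(\<forall>k. \<exists>j\<ge>k. p (\<pi> (m + j)) = c) \<longleftrightarrow> (\<forall>k. \<exists>j\<ge>k. p (\<pi> j) = c)" for c
  proof safe
    fix k
    show "\<exists>j\<ge>k. p (\<pi> j) = c" if "\<forall>k. \<exists>j\<ge>k. p (\<pi> (m + j)) = c"
      using that by (metis trans_le_add2)
    show "\<exists>j\<ge>k. p (\<pi> (m + j)) = c" if "\<forall>k. \<exists>j\<ge>k. p (\<pi> j) = c"
      using that by (metis add_le_cancel_left le_Suc_ex add.assoc le_add1)
  qed
  moreover have "(\<exists>k. \<forall>j\<ge>k. c \<le> p (\<pi> (m + j))) \<longleftrightarrow> (\<exists>k. \<forall>j\<ge>k. c \<le> p (\<pi> j))" for c
  proof safe
    fix k
    show "\<exists>k. \<forall>j\<ge>k. c \<le> p (\<pi> j)" if "\<forall>j\<ge>k. c \<le> p (\<pi> (m + j))"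
      using that by (intro exI[of _ "m + k"]) (metis add_le_cancel_left le_Suc_ex add.assoc le_add1)
    show "\<exists>k. \<forall>j\<ge>k. c \<le> p (\<pi> (m + j))" if "\<forall>j\<ge>k. c \<le> p (\<pi> j)"
      using that by (metis trans_le_add2)
  qed
  ultimately show ?thesis unfolding parity_def by simp
qed

lemmas parity_suffix = iffD1[OF parity_suffix_iff]

text \<open>\<open>parity\<close> states its condition by quantifiers over tails, which keeps it
  meaningful when infinitely many priorities occur. \<open>Min\<close> is unspecified on empty and
  infinite sets, hence the finiteness assumption.\<close>

lemma parity_iff_even_Min:
  assumes "finite (range (\<lambda>k. p (\<pi> k)))"
  shows "parity p \<pi> \<longleftrightarrow> even (Min {c. infinite {k. p (\<pi> k) = c}})"
proof -
  let ?S = "{c. infinite {k. p (\<pi> k) = c}}"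
  have fin: "finite ?S"
    by (rule finite_subset[OF _ assms]) (auto dest: infinite_imp_nonempty)
  have "\<exists>c. infinite {k. p (\<pi> k) = c}"
    using inf_img_fin_dom'[OF assms] by (auto simp: vimage_def)
  then have ne: "?S \<noteq> {}" by simp
  have inf: "infinite {k. p (\<pi> k) = c} \<longleftrightarrow> (\<forall>k. \<exists>j\<ge>k. p (\<pi> j) = c)" for c
    by (simp add: infinite_nat_iff_unbounded_le)
  \<comment> \<open>Finitely many values lie below the minimum and each of them occurs finitely
    often, so from some index on none occurs.\<close>
  have ev: "\<exists>k. \<forall>j\<ge>k. Min ?S \<le> p (\<pi> j)"
  proof -
    have "finite (\<Union>c\<in>{..<Min ?S}. {k. p (\<pi> k) = c})"
    proof (intro finite_UN_I)
      fix c assume "c \<in> {..<Min ?S}"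
      then have "c \<notin> ?S" using Min_le[OF fin, of c] by force
      then show "finite {k. p (\<pi> k) = c}" by simp
    qed simp
    then obtain k where "\<forall>j\<in>(\<Union>c\<in>{..<Min ?S}. {k. p (\<pi> k) = c}). j < k"
      by (auto simp: finite_nat_set_iff_bounded)
    then show ?thesis by (intro exI[of _ k]) (force simp: not_le[symmetric])
  qed
  show ?thesis
  proof
    assume "parity p \<pi>"
    then obtain c k where c: "even c" "\<And>k. \<exists>j\<ge>k. p (\<pi> j) = c" "\<And>j. j \<ge> k \<Longrightarrow> c \<le> p (\<pi> j)"
      unfolding parity_def by blast
    have "Min ?S = c"
    proof (rule Min_eqI[OF fin])
      show "c \<in> ?S" using c(2) inf by simp
      fix c' assume "c' \<in> ?S"
      then obtain j where "j \<ge> k" "p (\<pi> j) = c'" using inf[of c'] by blast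
      then show "c \<le> c'" using c(3) by blast
    qed
    with c(1) show "even (Min ?S)" by simp
  next
    assume "even (Min ?S)"
    moreover have "Min ?S \<in> ?S" using Min_in[OF fin ne] .
    ultimately show "parity p \<pi>"
      unfolding parity_def using ev inf by blast
  qed
qed

text \<open>An arena is a set of edges \<open>(v, a, v')\<close>: at \<open>v\<close>, Player 1 chooses an action \<open>a\<close> that occurs on some
  edge, then Player 2 chooses \<open>v'\<close>.\<close>

definition verts :: "('n \<times> 'a \<times> 'n) set \<Rightarrow> 'n set" where
  "verts E = fst ` E"

lemma verts_iff: "v \<in> verts E \<longleftrightarrow> (\<exists>a v'. (v, a, v') \<in> E)"
  by (force simp: verts_def)

definition closed_arena :: "('n \<times> 'a \<times> 'n) set \<Rightarrow> bool" where
  "closed_arena E \<longleftrightarrow> (\<forall>v a v'. (v, a, v') \<in> E \<longrightarrow> v' \<in> verts E)"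

text \<open>\<open>Inv x n\<close> says that memory state \<open>x\<close> is sound at node \<open>n\<close>. Paths may start at any sound pair, not
  only at an initial one, so every sound pair witnesses a win; this is what makes strategies easy to
  switch and to combine.\<close>

definition machine ::
  "('n \<times> 'a \<times> 'n) set \<Rightarrow> ((nat \<Rightarrow> 'n) \<Rightarrow> bool) \<Rightarrow>
   ('x \<Rightarrow> 'a) \<Rightarrow> ('x \<Rightarrow> 'n \<Rightarrow> 'x) \<Rightarrow> ('x \<Rightarrow> 'n \<Rightarrow> bool) \<Rightarrow> bool" where
  "machine E \<Phi> act nx Inv \<longleftrightarrow>
     (\<forall>x n. Inv x n \<longrightarrow>
        (\<exists>n'. (n, act x, n') \<in> E) \<and> (\<forall>n'. (n, act x, n') \<in> E \<longrightarrow> Inv (nx x n') n')) \<and>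
     (\<forall>\<xi> \<pi>. (\<forall>k. Inv (\<xi> k) (\<pi> k) \<and> (\<pi> k, act (\<xi> k), \<pi> (Suc k)) \<in> E \<and>
               \<xi> (Suc k) = nx (\<xi> k) (\<pi> (Suc k))) \<longrightarrow> \<Phi> \<pi>)"

lemma machineI:
  assumes "\<And>x n. Inv x n \<Longrightarrow> \<exists>n'. (n, act x, n') \<in> E"
    and "\<And>x n n'. Inv x n \<Longrightarrow> (n, act x, n') \<in> E \<Longrightarrow> Inv (nx x n') n'"
    and "\<And>\<xi> \<pi>. (\<And>k. Inv (\<xi> k) (\<pi> k)) \<Longrightarrow> (\<And>k. (\<pi> k, act (\<xi> k), \<pi> (Suc k)) \<in> E) \<Longrightarrow>
            (\<And>k. \<xi> (Suc k) = nx (\<xi> k) (\<pi> (Suc k))) \<Longrightarrow> \<Phi> \<pi>"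
  shows "machine E \<Phi> act nx Inv"
  unfolding machine_def using assms by (intro conjI allI impI) blast+

lemma machineD:
  assumes "machine E \<Phi> act nx Inv"
  shows "\<And>x n. Inv x n \<Longrightarrow> \<exists>n'. (n, act x, n') \<in> E"
    and "\<And>x n n'. Inv x n \<Longrightarrow> (n, act x, n') \<in> E \<Longrightarrow> Inv (nx x n') n'"
    and "\<And>\<xi> \<pi>. (\<And>k. Inv (\<xi> k) (\<pi> k)) \<Longrightarrow> (\<And>k. (\<pi> k, act (\<xi> k), \<pi> (Suc k)) \<in> E) \<Longrightarrow>
            (\<And>k. \<xi> (Suc k) = nx (\<xi> k) (\<pi> (Suc k))) \<Longrightarrow> \<Phi> \<pi>"
  using assms unfolding machine_def by blast+

text \<open>Node lists are a universal memory type, see \<open>machine_wins\<close>.\<close>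

definition wins :: "('n \<times> 'a \<times> 'n) set \<Rightarrow> ((nat \<Rightarrow> 'n) \<Rightarrow> bool) \<Rightarrow> 'n \<Rightarrow> bool" where
  "wins E \<Phi> n \<longleftrightarrow>
     (\<exists>(act :: 'n list \<Rightarrow> 'a) nx Inv x. machine E \<Phi> act nx Inv \<and> Inv x n)"

text \<open>A list records the nodes entered so far, and folding \<open>nx\<close> over it recovers
  the original memory. Thus \<open>wins\<close> avoids an existential over memory types, which HOL
  cannot express.\<close>

lemma machine_wins:
  fixes act :: "'x \<Rightarrow> 'a" and E :: "('n \<times> 'a \<times> 'n) set"
  assumes M: "machine E \<Phi> act nx Inv" and I: "Inv x0 n"
  shows "wins E \<Phi> n"
proof -
  let ?f = "foldl nx x0"
  have "machine E \<Phi> (\<lambda>h. act (?f h)) (\<lambda>h m. h @ [m]) (\<lambda>h. Inv (?f h))"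
  proof (rule machineI)
    fix \<xi> \<pi> assume "\<And>k. Inv (?f (\<xi> k)) (\<pi> k)" "\<And>k. (\<pi> k, act (?f (\<xi> k)), \<pi> (Suc k)) \<in> E"
      "\<And>k. \<xi> (Suc k) = \<xi> k @ [\<pi> (Suc k)]"
    then show "\<Phi> \<pi>" by (intro machineD(3)[OF M, of "\<lambda>k. ?f (\<xi> k)"]) auto
  qed (use machineD(1,2)[OF M] in auto)
  moreover have "Inv (?f []) n" using I by simp
  ultimately show ?thesis unfolding wins_def by blast
qed

lemma machine_mono:
  assumes "machine E \<Phi> act nx Inv" "\<And>\<pi>. \<Phi> \<pi> \<Longrightarrow> \<Psi> \<pi>"
  shows "machine E \<Psi> act nx Inv"
  using assms unfolding machine_def by blast

lemma wins_mono:
  assumes "wins E \<Phi> n" "\<And>\<pi>. \<Phi> \<pi> \<Longrightarrow> \<Psi> \<pi>"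
  shows "wins E \<Psi> n"
  using assms machine_mono unfolding wins_def by metis

text \<open>One machine serves all winning nodes: it remembers where it was started.\<close>

lemma wins_uniform:
  fixes E :: "('n \<times> 'a \<times> 'n) set"
  obtains act :: "'n \<times> 'n list \<Rightarrow> 'a" and nx Inv init
  where "machine E \<Phi> act nx Inv" "\<And>n. wins E \<Phi> n \<Longrightarrow> Inv (init n) n"
proof -
  have "\<forall>n. \<exists>(act :: 'n list \<Rightarrow> 'a) nx Inv x. wins E \<Phi> n \<longrightarrow> machine E \<Phi> act nx Inv \<and> Inv x n"
    unfolding wins_def by blast
  then obtain act :: "'n \<Rightarrow> 'n list \<Rightarrow> 'a" and nx Inv x where
    M: "\<And>n. wins E \<Phi> n \<Longrightarrow> machine E \<Phi> (act n) (nx n) (Inv n) \<and> Inv n (x n) n"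
    by metis
  let ?act = "\<lambda>(n, h). act n h" and ?nx = "\<lambda>(n, h) m. (n, nx n h m)"
    and ?Inv = "\<lambda>(n, h) m. wins E \<Phi> n \<and> Inv n h m"
  have "machine E \<Phi> ?act ?nx ?Inv"
  proof (rule machineI)
    fix \<xi> \<pi> assume a: "\<And>k. ?Inv (\<xi> k) (\<pi> k)" "\<And>k. (\<pi> k, ?act (\<xi> k), \<pi> (Suc k)) \<in> E"
      "\<And>k. \<xi> (Suc k) = ?nx (\<xi> k) (\<pi> (Suc k))"
    let ?n = "fst (\<xi> 0)"
    have c: "fst (\<xi> k) = ?n" for k
      by (induction k) (simp_all add: a(3) split_beta)
    have "wins E \<Phi> ?n" using a(1)[of 0] by (simp add: split_beta)
    with M have M': "machine E \<Phi> (act ?n) (nx ?n) (Inv ?n)" by blast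
    show "\<Phi> \<pi>"
    proof (rule machineD(3)[OF M', of "\<lambda>k. snd (\<xi> k)"])
      fix k
      show "Inv ?n (snd (\<xi> k)) (\<pi> k)" using a(1)[of k] c[of k] by (simp add: split_beta)
      show "(\<pi> k, act ?n (snd (\<xi> k)), \<pi> (Suc k)) \<in> E"
        using a(2)[of k] c[of k] by (simp add: split_beta)
      show "snd (\<xi> (Suc k)) = nx ?n (snd (\<xi> k)) (\<pi> (Suc k))"
        using a(3)[of k] c[of k] by (simp add: split_beta)
    qed
  next
    fix x n assume "?Inv x n"
    then show "\<exists>n'. (n, ?act x, n') \<in> E"
      using M machineD(1) by (cases x) fastforce
  next
    fix x n n' assume "?Inv x n" "(n, ?act x, n') \<in> E"
    then show "?Inv (?nx x n') n'"
      using M machineD(2) by (cases x) fastforce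
  qed
  moreover have "?Inv (n, x n) n" if "wins E \<Phi> n" for n
    using M that by simp
  ultimately show ?thesis by (rule that[of ?act ?nx ?Inv "\<lambda>n. (n, x n)"])
qed

text \<open>A sound pair is never stuck, so it starts an infinite play; whatever
  \<open>\<Phi>\<close> says about the first node of a play thus holds at every sound node.\<close>

lemma machine_path:
  assumes M: "machine E \<Phi> act nx Inv" and I: "Inv x n"
  obtains \<pi> where "\<pi> 0 = n" "\<Phi> \<pi>"
proof -
  define step where "step = (\<lambda>(x, n). let n' = (SOME n'. (n, act x, n') \<in> E) in (nx x n', n'))"
  define s where "s = (\<lambda>k. (step ^^ k) (x, n))"
  have st: "(m, act y, snd (step (y, m))) \<in> E"
       "fst (step (y, m)) = nx y (snd (step (y, m)))" if "Inv y m" for y m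
    using someI_ex[OF machineD(1)[OF M that]] by (simp_all add: step_def Let_def)
  have sS: "s (Suc k) = step (fst (s k), snd (s k))" for k by (simp add: s_def)
  have inv: "Inv (fst (s k)) (snd (s k))" for k
  proof (induction k)
    case 0 then show ?case using I by (simp add: s_def)
  next
    case (Suc k)
    show ?case using machineD(2)[OF M Suc st(1)[OF Suc]] st(2)[OF Suc] by (simp add: sS)
  qed
  have "\<Phi> (\<lambda>k. snd (s k))"
    by (rule machineD(3)[OF M, of "\<lambda>k. fst (s k)"]) (use inv st[OF inv] sS in auto)
  then show ?thesis by (rule that[rotated]) (simp add: s_def)
qed

text \<open>The map \<open>\<kappa>\<close> is the identity for the plain energy game and \<open>min Cap\<close> for the truncated one.\<close>

definition energy_arena ::
  "(int \<Rightarrow> int) \<Rightarrow> ('v \<Rightarrow> 'a \<Rightarrow> 'v \<Rightarrow> int) \<Rightarrow> ('v \<times> 'a \<times> 'v) set \<Rightarrow>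
   (('v \<times> int) \<times> 'a \<times> ('v \<times> int)) set" where
  "energy_arena \<kappa> wt E = {((v, e), a, (v', \<kappa> (e + wt v a v'))) | v e a v'. (v, a, v') \<in> E}"

lemma energy_arena_iff:
  "((v, e), a, (v', e')) \<in> energy_arena \<kappa> wt E \<longleftrightarrow> (v, a, v') \<in> E \<and> e' = \<kappa> (e + wt v a v')"
  by (auto simp: energy_arena_def)

lemma energy_arena_iff':
  "(n, a, n') \<in> energy_arena \<kappa> wt E \<longleftrightarrow>
     (fst n, a, fst n') \<in> E \<and> snd n' = \<kappa> (snd n + wt (fst n) a (fst n'))"
  by (cases n; cases n') (simp add: energy_arena_iff)

definition energy_parity :: "('v \<Rightarrow> nat) \<Rightarrow> (nat \<Rightarrow> 'v \<times> int) \<Rightarrow> bool" where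
  "energy_parity p \<pi> \<longleftrightarrow> (\<forall>k. 0 \<le> snd (\<pi> k)) \<and> parity p (\<lambda>k. fst (\<pi> k))"

definition all_win :: "('v \<Rightarrow> 'a \<Rightarrow> 'v \<Rightarrow> int) \<Rightarrow> ('v \<Rightarrow> nat) \<Rightarrow> ('v \<times> 'a \<times> 'v) set \<Rightarrow> bool" where
  "all_win wt p E \<longleftrightarrow> (\<forall>v\<in>verts E. \<exists>c. wins (energy_arena id wt E) (energy_parity p) (v, c))"

lemma energy_machine_nonneg:
  assumes "machine E (energy_parity p) act nx Inv" "Inv x (v, e)"
  shows "0 \<le> e"
  using machine_path[OF assms] unfolding energy_parity_def by (metis snd_conv)

text \<open>\<open>trap\<close> restricts the choices of Player 2 to \<open>X\<close>, \<open>region\<close> those of Player 1.\<close>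

definition trap :: "'v set \<Rightarrow> ('v \<times> 'a \<times> 'v) set \<Rightarrow> ('v \<times> 'a \<times> 'v) set" where
  "trap X E = {(v, a, v'). (v, a, v') \<in> E \<and> v \<in> X \<and> v' \<in> X}"

definition region :: "'v set \<Rightarrow> ('v \<times> 'a \<times> 'v) set \<Rightarrow> ('v \<times> 'a \<times> 'v) set" where
  "region X E = {(v, a, v'). (v, a, v') \<in> E \<and> v \<in> X \<and> (\<forall>v''. (v, a, v'') \<in> E \<longrightarrow> v'' \<in> X)}"

text \<open>By \<open>esc\<close>, Player 2 can remain in \<open>X\<close> whatever action is chosen
  there. Hence the restriction removes only options of Player 2, and a machine stays playable and
  winning on \<open>X\<close>.\<close>

lemma trap_all_win:
  fixes E :: "('v \<times> 'a \<times> 'v) set"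
  assumes X: "X \<subseteq> verts E"
    and esc: "\<And>v a v'. v \<in> X \<Longrightarrow> (v, a, v') \<in> E \<Longrightarrow> \<exists>v''\<in>X. (v, a, v'') \<in> E"
    and H: "all_win wt p E"
  shows "verts (trap X E) = X" "closed_arena (trap X E)" "all_win wt p (trap X E)"
proof -
  show V: "verts (trap X E) = X"
    using X esc by (fastforce simp: verts_iff trap_def)
  show "closed_arena (trap X E)"
    unfolding closed_arena_def V by (simp add: trap_def)
  show "all_win wt p (trap X E)"
    unfolding all_win_def V
  proof
    fix v assume v: "v \<in> X"
    then obtain c where "wins (energy_arena id wt E) (energy_parity p) (v, c)"
      using H X unfolding all_win_def by blast
    then obtain act :: "('v \<times> int) list \<Rightarrow> 'a" and nx Inv x where
      M: "machine (energy_arena id wt E) (energy_parity p) act nx Inv" and I: "Inv x (v, c)"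
      unfolding wins_def by blast
    have "machine (energy_arena id wt (trap X E)) (energy_parity p) act nx (\<lambda>x n. Inv x n \<and> fst n \<in> X)"
    proof (rule machineI)
      fix x n assume a: "Inv x n \<and> fst n \<in> X"
      then obtain n' where "(n, act x, n') \<in> energy_arena id wt E" using machineD(1)[OF M] by blast
      then obtain v'' where "v'' \<in> X" "(fst n, act x, v'') \<in> E"
        using esc a by (meson energy_arena_iff')
      then have "(n, act x, (v'', snd n + wt (fst n) (act x) v'')) \<in> energy_arena id wt (trap X E)"
        using a by (simp add: energy_arena_iff' trap_def)
      then show "\<exists>n'. (n, act x, n') \<in> energy_arena id wt (trap X E)" by blast
    next
      fix x n n' assume "Inv x n \<and> fst n \<in> X" "(n, act x, n') \<in> energy_arena id wt (trap X E)"
      then show "Inv (nx x n') n' \<and> fst n' \<in> X"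
        using machineD(2)[OF M, of x n n'] by (simp add: energy_arena_iff' trap_def)
    next
      fix \<xi> \<pi> assume "\<And>k. Inv (\<xi> k) (\<pi> k) \<and> fst (\<pi> k) \<in> X"
        "\<And>k. (\<pi> k, act (\<xi> k), \<pi> (Suc k)) \<in> energy_arena id wt (trap X E)"
        "\<And>k. \<xi> (Suc k) = nx (\<xi> k) (\<pi> (Suc k))"
      then show "energy_parity p \<pi>"
        by (intro machineD(3)[OF M, of \<xi>]) (simp_all add: energy_arena_iff' trap_def)
    qed
    then show "\<exists>c. wins (energy_arena id wt (trap X E)) (energy_parity p) (v, c)"
      using machine_wins[of _ _ _ _ _ x] I v by fastforce
  qed
qed

text \<open>All successors under a winning machine are again sound, hence winning, so none of its
  actions is removed. This works for an arbitrary \<open>\<Phi>\<close> because every sound pair,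
  not only a starting one, witnesses a win.\<close>

lemma region_wins:
  fixes E :: "('v \<times> 'a \<times> 'v) set"
  assumes Z: "Z = {v. \<exists>c. wins (energy_arena id wt E) \<Phi> (v, c)}"
  shows "verts (region Z E) = Z" "closed_arena (region Z E)"
    "\<And>v c. wins (energy_arena id wt E) \<Phi> (v, c) \<Longrightarrow> wins (energy_arena id wt (region Z E)) \<Phi> (v, c)"
proof -
  obtain act :: "('v \<times> int) \<times> ('v \<times> int) list \<Rightarrow> 'a" and nx Inv init where
    M: "machine (energy_arena id wt E) \<Phi> act nx Inv"
    and I: "\<And>n. wins (energy_arena id wt E) \<Phi> n \<Longrightarrow> Inv (init n) n"
    using wins_uniform by blast
  have inZ: "fst n \<in> Z" if "Inv x n" for x n
    using machine_wins[of _ _ _ _ Inv x n, OF M that] unfolding Z by (cases n) auto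
  have edge: "(n, act x, n') \<in> energy_arena id wt (region Z E) \<longleftrightarrow> (n, act x, n') \<in> energy_arena id wt E"
    if "Inv x n" for x n n'
  proof -
    have "v'' \<in> Z" if "(fst n, act x, v'') \<in> E" for v''
    proof -
      have "(n, act x, (v'', snd n + wt (fst n) (act x) v'')) \<in> energy_arena id wt E"
        using that by (simp add: energy_arena_iff')
      from inZ[OF machineD(2)[OF M \<open>Inv x n\<close> this]] show ?thesis by simp
    qed
    then show ?thesis using inZ[OF that] by (auto simp: energy_arena_iff' region_def)
  qed
  have M': "machine (energy_arena id wt (region Z E)) \<Phi> act nx Inv"
  proof (rule machineI)
    fix \<xi> \<pi> assume a: "\<And>k. Inv (\<xi> k) (\<pi> k)"
        "\<And>k. (\<pi> k, act (\<xi> k), \<pi> (Suc k)) \<in> energy_arena id wt (region Z E)"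
        "\<And>k. \<xi> (Suc k) = nx (\<xi> k) (\<pi> (Suc k))"
    show "\<Phi> \<pi>" by (rule machineD(3)[OF M, of \<xi>]) (use a edge in blast)+
  qed (use machineD(1,2)[OF M] edge in blast)+
  show w: "wins (energy_arena id wt (region Z E)) \<Phi> (v, c)"
    if "wins (energy_arena id wt E) \<Phi> (v, c)" for v c
    using machine_wins[OF M'] I[OF that] by blast
  show V: "verts (region Z E) = Z"
  proof
    show "verts (region Z E) \<subseteq> Z" by (auto simp: verts_iff region_def)
    show "Z \<subseteq> verts (region Z E)"
    proof
      fix v assume "v \<in> Z"
      then obtain c where "wins (energy_arena id wt E) \<Phi> (v, c)" unfolding Z by blast
      from machineD(1)[OF M' I[OF this]] show "v \<in> verts (region Z E)"
        by (auto simp: verts_iff energy_arena_iff')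
    qed
  qed
  show "closed_arena (region Z E)"
    unfolding closed_arena_def V by (simp add: region_def)
qed

text \<open>Taking a maximal ranked set instead of iterating the predecessor operator bounds the ranks for free:
  a vertex is added with the current cardinality as its rank.\<close>

lemma attractor:
  fixes E :: "('v \<times> 'a \<times> 'v) set"
  assumes fin: "finite (verts E)" and cl: "closed_arena E" and T: "T \<subseteq> verts E"
  obtains A rk \<alpha> where "T \<subseteq> A" "A \<subseteq> verts E"
    "\<And>v. v \<in> A \<Longrightarrow> rk v + card T \<le> card A"
    "\<And>v. v \<in> A - T \<Longrightarrow> \<exists>v'. (v, \<alpha> v, v') \<in> E"
    "\<And>v v'. v \<in> A - T \<Longrightarrow> (v, \<alpha> v, v') \<in> E \<Longrightarrow> v' \<in> A \<and> rk v' < rk v"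
    "\<And>v a v'. v \<in> verts E - A \<Longrightarrow> (v, a, v') \<in> E \<Longrightarrow> \<exists>v''\<in>verts E - A. (v, a, v'') \<in> E"
proof -
  define good where "good = (\<lambda>A (rk :: 'v \<Rightarrow> nat) (\<alpha> :: 'v \<Rightarrow> 'a). T \<subseteq> A \<and> A \<subseteq> verts E \<and>
    (\<forall>v\<in>A. rk v + card T \<le> card A) \<and> (\<forall>v\<in>A - T. \<exists>v'. (v, \<alpha> v, v') \<in> E) \<and>
    (\<forall>v\<in>A - T. \<forall>v'. (v, \<alpha> v, v') \<in> E \<longrightarrow> v' \<in> A \<and> rk v' < rk v))"
  let ?S = "{A. \<exists>rk \<alpha>. good A rk \<alpha>}"
  have "finite ?S"
    by (rule finite_subset[of _ "Pow (verts E)"]) (use fin in \<open>auto simp: good_def\<close>)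
  moreover have "good T (\<lambda>_. 0) (\<lambda>_. undefined)" using T by (simp add: good_def)
  then have "?S \<noteq> {}" by blast
  ultimately obtain A where A: "A \<in> ?S" and mx: "\<And>B. B \<in> ?S \<Longrightarrow> A \<subseteq> B \<Longrightarrow> A = B"
    using finite_has_maximal by (metis (no_types, lifting))
  then obtain rk \<alpha> where g: "good A rk \<alpha>" by blast
  have finA: "finite A" using g fin by (auto simp: good_def intro: finite_subset)
  have "\<exists>v''\<in>verts E - A. (v, a, v'') \<in> E" if v: "v \<in> verts E - A" and e: "(v, a, v') \<in> E" for v a v'
  proof (rule ccontr)
    assume "\<not> ?thesis"
    then have *: "v'' \<in> A" if "(v, a, v'') \<in> E" for v''
      using that cl unfolding closed_arena_def by blast
    have "card T \<le> card A" using g finA by (auto simp: good_def intro: card_mono)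
    \<comment> \<open>Ranks in \<open>A\<close> are at most \<open>card A - card T\<close>, so the
      rank given to \<open>v\<close> is larger than all of them, and it meets the bound for
      \<open>insert v A\<close> with equality.\<close>
    then have "good (insert v A) (rk(v := Suc (card A) - card T)) (\<alpha>(v := a))"
      using g v e * finA unfolding good_def
      by (auto simp: le_SucI Suc_le_eq less_Suc_eq_le Suc_diff_le le_diff_conv2)
    then have "A = insert v A" by (intro mx) auto
    with v show False by blast
  qed
  with g show ?thesis by (intro that[of A rk \<alpha>]) (auto simp: good_def)
qed

section \<open>Required credit\<close>

text \<open>While the play stays in \<open>U\<close>, the given machine runs with a believed energy
  \<open>\<delta>\<close> above the true one, and \<open>safe\<close> keeps the true one
  nonnegative. On leaving \<open>U\<close>, a fresh winning machine takes over at the true energy. A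
  play switches at most once, so one of the two machines settles its parity.\<close>

lemma shift_wins:
  fixes E :: "('v \<times> 'a \<times> 'v) set" and act :: "'x \<Rightarrow> 'a"
  assumes M: "machine (energy_arena id wt E) (energy_parity p) act nx Inv"
    and I: "Inv x0 (v0, e0)" "v0 \<in> U"
    and safe: "\<And>x v e. Inv x (v, e) \<Longrightarrow> v \<in> U \<Longrightarrow> \<delta> \<le> e"
    and exit: "\<And>x v e v'. Inv x (v, e) \<Longrightarrow> v \<in> U \<Longrightarrow> (v, act x, v') \<in> E \<Longrightarrow> v' \<notin> U \<Longrightarrow>
        wins (energy_arena id wt E) (energy_parity p) (v', e + wt v (act x) v' - \<delta>)"
  shows "wins (energy_arena id wt E) (energy_parity p) (v0, e0 - \<delta>)"
proof -
  let ?E = "energy_arena id wt E"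
  obtain act2 :: "('v \<times> int) \<times> ('v \<times> int) list \<Rightarrow> 'a" and nx2 Inv2 init2 where
    M2: "machine ?E (energy_parity p) act2 nx2 Inv2"
    and I2: "\<And>n. wins ?E (energy_parity p) n \<Longrightarrow> Inv2 (init2 n) n"
    using wins_uniform by blast
  define act' where "act' = case_sum act act2"
  define nx' where "nx' = (\<lambda>s n. case s of
      Inl x \<Rightarrow> if fst n \<in> U then Inl (nx x (fst n, snd n + \<delta>)) else Inr (init2 n)
    | Inr y \<Rightarrow> Inr (nx2 y n))"
  define Inv' where "Inv' = (\<lambda>s n. case s of
      Inl x \<Rightarrow> Inv x (fst n, snd n + \<delta>) \<and> fst n \<in> U
    | Inr y \<Rightarrow> Inv2 y n)"
  have "machine ?E (energy_parity p) act' nx' Inv'"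
  proof (rule machineI)
    fix s n assume s: "Inv' s n"
    show "\<exists>n'. (n, act' s, n') \<in> ?E"
    proof (cases s)
      case (Inl x)
      then obtain n' where "((fst n, snd n + \<delta>), act x, n') \<in> ?E"
        using s machineD(1)[OF M, of x "(fst n, snd n + \<delta>)"] by (auto simp: Inv'_def)
      then have "(n, act x, (fst n', snd n' - \<delta>)) \<in> ?E" by (simp add: energy_arena_iff')
      then show ?thesis using Inl by (auto simp: act'_def)
    next
      case (Inr y) then show ?thesis using s machineD(1)[OF M2] by (auto simp: Inv'_def act'_def)
    qed
  next
    fix s n n' assume s: "Inv' s n" and e: "(n, act' s, n') \<in> ?E"
    show "Inv' (nx' s n') n'"
    proof (cases s)
      case (Inl x)
      then have i: "Inv x (fst n, snd n + \<delta>)" "fst n \<in> U" using s by (auto simp: Inv'_def)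
      have e': "((fst n, snd n + \<delta>), act x, (fst n', snd n' + \<delta>)) \<in> ?E"
        using e Inl by (simp add: energy_arena_iff' act'_def)
      have "wins ?E (energy_parity p) n'" if "fst n' \<notin> U"
        using exit[OF i _ that] e Inl by (cases n') (simp add: energy_arena_iff' act'_def algebra_simps)
      then show ?thesis
        using machineD(2)[OF M i(1) e'] Inl I2[of n'] by (simp add: Inv'_def nx'_def)
    next
      case (Inr y) then show ?thesis
        using s e machineD(2)[OF M2] by (auto simp: Inv'_def act'_def nx'_def)
    qed
  next
    fix \<xi> \<pi> assume a: "\<And>k. Inv' (\<xi> k) (\<pi> k)" and e: "\<And>k. (\<pi> k, act' (\<xi> k), \<pi> (Suc k)) \<in> ?E"
      and n: "\<And>k. \<xi> (Suc k) = nx' (\<xi> k) (\<pi> (Suc k))"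
    have pos: "0 \<le> snd (\<pi> k)" for k
    proof (cases "\<xi> k")
      case (Inl x)
      then show ?thesis using a[of k] safe[of x "fst (\<pi> k)" "snd (\<pi> k) + \<delta>"] by (simp add: Inv'_def)
    next
      case (Inr y)
      then have "Inv2 y (fst (\<pi> k), snd (\<pi> k))" using a[of k] by (simp add: Inv'_def)
      then show ?thesis by (rule energy_machine_nonneg[OF M2])
    qed
    have "parity p (\<lambda>k. fst (\<pi> k))"
    proof (cases "\<exists>m y. \<xi> m = Inr y")
      case True
      then obtain m y where m: "\<xi> m = Inr y" by blast
      have r: "\<exists>z. \<xi> (m + k) = Inr z" for k
      proof (induction k)
        case (Suc k)
        then obtain z where "\<xi> (m + k) = Inr z" by blast
        then have "\<xi> (m + Suc k) = Inr (nx2 z (\<pi> (m + Suc k)))" using n[of "m + k"] by (simp add: nx'_def)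
        then show ?case by blast
      qed (simp add: m)
      have "energy_parity p (\<lambda>k. \<pi> (m + k))"
      proof (rule machineD(3)[OF M2, of "\<lambda>k. projr (\<xi> (m + k))"])
        fix k obtain z where z: "\<xi> (m + k) = Inr z" using r by blast
        show "Inv2 (projr (\<xi> (m + k))) (\<pi> (m + k))" using a[of "m + k"] z by (simp add: Inv'_def)
        show "(\<pi> (m + k), act2 (projr (\<xi> (m + k))), \<pi> (m + Suc k)) \<in> ?E"
          using e[of "m + k"] z by (simp add: act'_def)
        show "projr (\<xi> (m + Suc k)) = nx2 (projr (\<xi> (m + k))) (\<pi> (m + Suc k))"
          using n[of "m + k"] z by (simp add: nx'_def)
      qed
      then show ?thesis unfolding energy_parity_def
        by (auto intro: parity_suffix[of p "\<lambda>k. fst (\<pi> k)" m])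
    next
      case False
      then have l: "\<exists>x. \<xi> k = Inl x" for k by (metis sumE)
      have "energy_parity p (\<lambda>k. (fst (\<pi> k), snd (\<pi> k) + \<delta>))"
      proof (rule machineD(3)[OF M, of "\<lambda>k. projl (\<xi> k)"])
        fix k obtain x where x: "\<xi> k = Inl x" using l by blast
        obtain x' where x': "\<xi> (Suc k) = Inl x'" using l by blast
        show "Inv (projl (\<xi> k)) (fst (\<pi> k), snd (\<pi> k) + \<delta>)" using a[of k] x by (simp add: Inv'_def)
        show "((fst (\<pi> k), snd (\<pi> k) + \<delta>), act (projl (\<xi> k)), fst (\<pi> (Suc k)), snd (\<pi> (Suc k)) + \<delta>) \<in> ?E"
          using e[of k] x by (simp add: act'_def energy_arena_iff')
        show "projl (\<xi> (Suc k)) = nx (projl (\<xi> k)) (fst (\<pi> (Suc k)), snd (\<pi> (Suc k)) + \<delta>)"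
          using n[of k] x x' by (auto simp: nx'_def split: if_splits)
      qed
      then show ?thesis by (simp add: energy_parity_def)
    qed
    with pos show "energy_parity p \<pi>" by (simp add: energy_parity_def)
  qed
  moreover have "Inv' (Inl x0) (v0, e0 - \<delta>)" using I by (simp add: Inv'_def)
  ultimately show ?thesis by (rule machine_wins)
qed

lemma wins_more_energy:
  assumes "wins (energy_arena id wt E) (energy_parity p) (v, c)" "c \<le> c'"
  shows "wins (energy_arena id wt E) (energy_parity p) (v, c')"
proof -
  obtain act :: "('a \<times> int) list \<Rightarrow> 'b" and nx Inv x where
    M: "machine (energy_arena id wt E) (energy_parity p) act nx Inv" and I: "Inv x (v, c)"
    using assms(1) unfolding wins_def by blast
  \<comment> \<open>A shift by a nonpositive amount hides the surplus from the machine, and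
    \<open>UNIV\<close> is never left.\<close>
  have "wins (energy_arena id wt E) (energy_parity p) (v, c - (c - c'))"
  proof (rule shift_wins[OF M I, of UNIV])
    show "c - c' \<le> e" if "Inv x (v, e)" for x v e
      using energy_machine_nonneg[OF M that] assms(2) by simp
  qed simp_all
  then show ?thesis by simp
qed

text \<open>If some required credit exceeded \<open>(N - 1) B\<close>, then the \<open>N\<close> required credits would leave out an
  interval of length \<open>B\<close>. A play above this gap cannot jump over it in one step, so the vertices
  above could be won with one unit less.\<close>

lemma credit_bound:
  fixes B :: int
  assumes fin: "finite (verts E)" and cl: "closed_arena E" and H: "all_win wt p E" and B: "1 \<le> B"
    and bd: "\<And>v a v'. (v, a, v') \<in> E \<Longrightarrow> \<bar>wt v a v'\<bar> \<le> B" and v: "v \<in> verts E"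
  shows "wins (energy_arena id wt E) (energy_parity p) (v, (int (card (verts E)) - 1) * B)"
proof (rule ccontr)
  let ?V = "verts E" and ?N = "card (verts E)"
  let ?W = "\<lambda>v c. wins (energy_arena id wt E) (energy_parity p) (v, c)"
  assume neg: "\<not> ?W v ((int ?N - 1) * B)"
  obtain act :: "('a \<times> int) \<times> ('a \<times> int) list \<Rightarrow> 'b" and nx Inv init where
    M: "machine (energy_arena id wt E) (energy_parity p) act nx Inv"
    and I: "\<And>n. wins (energy_arena id wt E) (energy_parity p) n \<Longrightarrow> Inv (init n) n"
    using wins_uniform by blast
  have W0: "0 \<le> c" if "?W u c" for u c
    using energy_machine_nonneg[OF M I[OF that]] .
  define cr where "cr u = int (LEAST c. ?W u (int c))" for u
  have ex: "\<exists>c::nat. ?W u (int c)" if "u \<in> ?V" for u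
  proof -
    obtain c where "?W u c" using H \<open>u \<in> ?V\<close> unfolding all_win_def by blast
    with W0[OF this] show ?thesis by (metis nonneg_int_cases)
  qed
  have crW: "?W u (cr u)" if "u \<in> ?V" for u
    unfolding cr_def using LeastI_ex[OF ex[OF that]] .
  have cr_le: "cr u \<le> c" if "?W u c" for u c
  proof -
    have "?W u (int (nat c))" using that W0[OF that] by simp
    then have "(LEAST c. ?W u (int c)) \<le> nat c" by (rule Least_le)
    then show ?thesis using W0[OF that] by (simp add: cr_def)
  qed
  have cr0: "0 \<le> cr u" for u by (simp add: cr_def)
  have vbig: "(int ?N - 1) * B < cr v"
    using wins_more_energy[OF crW[OF v], of "(int ?N - 1) * B"] neg by (simp add: not_le[symmetric]) blast
  \<comment> \<open>\<open>(cr u + (B - 1)) div B\<close> is \<open>cr u / B\<close> rounded up. For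
    \<open>v\<close> it is at least \<open>?N\<close>, so the other \<open>?N - 1\<close> vertices
    cannot fill all the values below \<open>?N\<close>.\<close>
  have "\<exists>j<?N. \<forall>u\<in>?V. (cr u + (B - 1)) div B \<noteq> int j"
  proof (rule ccontr)
    assume "\<not> ?thesis"
    then have all: "\<forall>j<?N. \<exists>u\<in>?V. (cr u + (B - 1)) div B = int j" by auto
    have notv: "(cr v + (B - 1)) div B \<noteq> int j" if "j < ?N" for j
    proof -
      have "int ?N * B \<le> cr v + (B - 1)" using vbig by (simp add: algebra_simps)
      then have "int ?N * B div B \<le> (cr v + (B - 1)) div B" using B by (intro zdiv_mono1) auto
      then show ?thesis using B that by simp
    qed
    have "int ` {..<?N} \<subseteq> (\<lambda>u. (cr u + (B - 1)) div B) ` (?V - {v})"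
      using all notv by (force simp: image_iff)
    then have "card (int ` {..<?N}) \<le> card ((\<lambda>u. (cr u + (B - 1)) div B) ` (?V - {v}))"
      using fin by (intro card_mono) auto
    also have "\<dots> \<le> card (?V - {v})" using fin by (intro card_image_le) auto
    also have "\<dots> < ?N" using fin v by (intro psubset_card_mono) auto
    finally show False by (simp add: card_image)
  qed
  then obtain j where j: "j < ?N" "\<And>u. u \<in> ?V \<Longrightarrow> (cr u + (B - 1)) div B \<noteq> int j" by blast
  \<comment> \<open>As the value \<open>j\<close> is missed, no credit lies between
    \<open>(j - 1) B + 1\<close> and \<open>j B\<close>; \<open>?s\<close> is the first number above
    this gap.\<close>
  let ?s = "int j * B + 1"
  let ?U = "{u. ?s \<le> cr u}"
  have gap: "cr u \<le> ?s - B - 1" if "u \<in> ?V" "u \<notin> ?U" for u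
  proof -
    have 1: "cr u \<le> int j * B" using that by simp
    have "\<not> (int j * B - B + 1 \<le> cr u)"
    proof
      assume "int j * B - B + 1 \<le> cr u"
      then have "(cr u + (B - 1)) div B = int j"
        using 1 B by (intro int_div_pos_eq[of _ _ _ "cr u + (B - 1) - int j * B"]) (auto simp: algebra_simps)
      with j(2) that(1) show False by blast
    qed
    then show ?thesis by simp
  qed
  have "int j * B \<le> (int ?N - 1) * B" using j(1) B by (intro mult_right_mono) auto
  then have vU: "v \<in> ?U" using vbig by simp
  have s1: "1 \<le> ?s" using B by simp
  \<comment> \<open>Above the gap the energy is at least \<open>?s\<close>, which is positive. A
    step out of \<open>?U\<close> costs at most \<open>B\<close> and so arrives with at least
    \<open>?s - B\<close>, one unit more than any credit below the gap.\<close>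
  have "?W v (cr v - 1)"
  proof (rule shift_wins[OF M I[OF crW[OF v]] vU])
    show "1 \<le> e" if "Inv x (u, e)" "u \<in> ?U" for x u e
      using cr_le[OF machine_wins[of _ _ _ _ Inv, OF M that(1)]] that(2) s1 by simp
  next
    fix x u e u' assume a: "Inv x (u, e)" "u \<in> ?U" "(u, act x, u') \<in> E" "u' \<notin> ?U"
    have "cr u \<le> e" using cr_le[OF machine_wins[of _ _ _ _ Inv, OF M a(1)]] .
    moreover have "u' \<in> ?V" using a(3) cl unfolding closed_arena_def by blast
    moreover have "cr u' \<le> ?s - B - 1" using gap[OF \<open>u' \<in> ?V\<close> a(4)] .
    ultimately have "cr u' \<le> e + wt u (act x) u' - 1"
      using a(2) bd[OF a(3)] by simp
    then show "?W u' (e + wt u (act x) u' - 1)"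
      using wins_more_energy[OF crW[OF \<open>u' \<in> ?V\<close>]] by blast
  qed
  from cr_le[OF this] show False by simp
qed

text \<open>Fixing a winning machine leaves a graph in which only Player 2 moves. If priority
  \<open>m\<close> could be reached from every sound pair, Player 2 could return to it again and
  again, and \<open>m\<close> would be the least recurring priority of a winning play. So some sound
  pair never reaches \<open>m\<close>.\<close>

lemma wins_avoiding_odd:
  assumes H: "all_win wt p E" and ne: "verts E \<noteq> {}"
    and mn: "\<And>v. v \<in> verts E \<Longrightarrow> m \<le> p v" and odd: "odd m"
  shows "\<exists>v c. wins (energy_arena id wt E) (\<lambda>\<pi>. energy_parity p \<pi> \<and> (\<forall>k. p (fst (\<pi> k)) \<noteq> m)) (v, c)"
proof -
  let ?E = "energy_arena id wt E"
  obtain v c where "wins ?E (energy_parity p) (v, c)"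
    using H ne unfolding all_win_def by blast
  then obtain act :: "('a \<times> int) list \<Rightarrow> 'b" and nx Inv x where
      M: "machine ?E (energy_parity p) act nx Inv" and I: "Inv x (v, c)"
      unfolding wins_def by blast
  define S where "S = {((x, n), (nx x n', n')) | x n n'. Inv x n \<and> (n, act x, n') \<in> ?E}"
  define hit where "hit = (\<lambda>s :: ('a \<times> int) list \<times> 'a \<times> int. p (fst (snd s)) = m)"
  have SInv: "Inv (fst t) (snd t)" if "(s, t) \<in> S" for s t
    using that machineD(2)[OF M] by (auto simp: S_def)
  have ex: "\<exists>s. Inv (fst s) (snd s) \<and> (\<forall>t. (s, t) \<in> S\<^sup>* \<longrightarrow> \<not> hit t)"
  proof (rule ccontr)
    assume "\<not> ?thesis"
    then have reach: "\<exists>k t. (s, t) \<in> S ^^ k \<and> hit t" if "Inv (fst s) (snd s)" for s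
      using that rtrancl_power by metis
    \<comment> \<open>Always moving closer to the nearest hit turns reachability from every sound
      pair into infinitely many hits on a single play.\<close>
    define dist where "dist s = (LEAST k. \<exists>t. (s, t) \<in> S ^^ k \<and> hit t)" for s
    have step: "\<exists>s'. (s, s') \<in> S \<and> (\<not> hit s \<longrightarrow> dist s' < dist s)" if i: "Inv (fst s) (snd s)" for s
    proof (cases "hit s")
      case True
      then show ?thesis using machineD(1)[OF M i] i unfolding S_def by (cases s) auto
    next
      case False
      obtain t where t: "(s, t) \<in> S ^^ dist s" "hit t"
        using LeastI_ex[OF reach[OF i]] unfolding dist_def by blast
      obtain k where k: "dist s = Suc k" using t False by (cases "dist s") auto
      then obtain s' where s': "(s, s') \<in> S" "(s', t) \<in> S ^^ k"
        using t(1) relpow_Suc_D2 by metis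
      then have "dist s' \<le> k" unfolding dist_def using t(2) by (blast intro: Least_le)
      then show ?thesis using s'(1) k less_Suc_eq_le by metis
    qed
    define next_state where "next_state s = (SOME s'. (s, s') \<in> S \<and> (\<not> hit s \<longrightarrow> dist s' < dist s))" for s
    define q where "q = (\<lambda>k. (next_state ^^ k) (x, (v, c)))"
    have q: "(q k, q (Suc k)) \<in> S \<and> (\<not> hit (q k) \<longrightarrow> dist (q (Suc k)) < dist (q k))"
      if "Inv (fst (q k)) (snd (q k))" for k
      using someI_ex[OF step[OF that]] by (simp add: q_def next_state_def)
    have qI: "Inv (fst (q k)) (snd (q k))" for k
      by (induction k) (use I q SInv in \<open>simp add: q_def, blast\<close>)
    have "energy_parity p (\<lambda>k. snd (q k))"
    proof (rule machineD(3)[OF M, of "\<lambda>k. fst (q k)"])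
      fix k
      show "(snd (q k), act (fst (q k)), snd (q (Suc k))) \<in> ?E"
        using q[OF qI, of k] by (auto simp: S_def)
      show "fst (q (Suc k)) = nx (fst (q k)) (snd (q (Suc k)))"
        using q[OF qI, of k] by (auto simp: S_def)
    qed (rule qI)
    then obtain c k where c: "even c" "\<And>k. \<exists>j\<ge>k. p (fst (snd (q j))) = c"
        "\<And>j. j \<ge> k \<Longrightarrow> c \<le> p (fst (snd (q j)))"
      unfolding energy_parity_def parity_def by blast
    have "\<exists>j\<ge>l. hit (q j)" for l
    proof (induction "dist (q l)" arbitrary: l rule: less_induct)
      case less
      show ?case
      proof (cases "hit (q l)")
        case False
        then obtain j where "j \<ge> Suc l" "hit (q j)" using less q[OF qI, of l] by blast
        then show ?thesis using Suc_leD by blast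
      qed blast
    qed
    then obtain j where "j \<ge> k" "hit (q j)" by blast
    then have "c \<le> m" using c(3)[of j] by (simp add: hit_def)
    moreover obtain i where "p (fst (snd (q i))) = c" using c(2) by blast
    moreover have "fst (snd (q i)) \<in> verts E"
      using machineD(1)[OF M qI, of i] by (auto simp: verts_iff energy_arena_iff')
    ultimately have "c = m" using mn by force
    then show False using c(1) odd by simp
  qed
  then obtain s where s: "Inv (fst s) (snd s)" and av: "\<And>t. (s, t) \<in> S\<^sup>* \<Longrightarrow> \<not> hit t"
    by blast
  have "machine ?E (\<lambda>\<pi>. energy_parity p \<pi> \<and> (\<forall>k. p (fst (\<pi> k)) \<noteq> m)) act nx
      (\<lambda>x n. Inv x n \<and> (s, (x, n)) \<in> S\<^sup>*)"
  proof (rule machineI)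
    fix x n n' assume a: "Inv x n \<and> (s, (x, n)) \<in> S\<^sup>*" "(n, act x, n') \<in> ?E"
    then have "((x, n), (nx x n', n')) \<in> S" unfolding S_def by blast
    then show "Inv (nx x n') n' \<and> (s, (nx x n', n')) \<in> S\<^sup>*"
      using a(1) SInv[of "(x, n)" "(nx x n', n')"] by (auto intro: rtrancl_into_rtrancl)
  next
    fix \<xi> \<pi> assume a: "\<And>k. Inv (\<xi> k) (\<pi> k) \<and> (s, (\<xi> k, \<pi> k)) \<in> S\<^sup>*"
      "\<And>k. (\<pi> k, act (\<xi> k), \<pi> (Suc k)) \<in> ?E" "\<And>k. \<xi> (Suc k) = nx (\<xi> k) (\<pi> (Suc k))"
    show "energy_parity p \<pi> \<and> (\<forall>k. p (fst (\<pi> k)) \<noteq> m)"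
    proof
      show "energy_parity p \<pi>" using a by (intro machineD(3)[OF M, of \<xi>]) blast+
      show "\<forall>k. p (fst (\<pi> k)) \<noteq> m" using a(1) av[unfolded hit_def] by fastforce
    qed
  qed (use machineD(1)[OF M] in blast)
  from machine_wins[OF this, of "fst s" "snd s"] s show ?thesis
    by (cases s rule: prod_cases3) auto
qed

section \<open>Positional strategies\<close>

text \<open>The recursion of Zielonka's algorithm, shared by the positional and the truncated case.
  Player 1 forces the play from \<open>A\<close> to \<open>T\<close>; the complement of
  \<open>A\<close> is a trap for her, hence again won everywhere. \<open>T\<close> is nonempty, and
  for odd \<open>m\<close> it is a proper subset because it misses \<open>m\<close>, so the
  recursive calls concern smaller arenas.\<close>

lemma decomposition:
  fixes E :: "('v \<times> 'a \<times> 'v) set"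
  assumes fin: "finite (verts E)" and cl: "closed_arena E" and H: "all_win wt p E"
    and ne: "verts E \<noteq> {}"
  obtains m T A rk \<alpha> where "\<And>v. v \<in> verts E \<Longrightarrow> m \<le> p v" "m \<in> p ` verts E"
    "T \<noteq> {}" "T \<subseteq> A" "A \<subseteq> verts E"
    "\<And>v. v \<in> A \<Longrightarrow> rk v + card T \<le> card A"
    "\<And>v. v \<in> A - T \<Longrightarrow> \<exists>v'. (v, \<alpha> v, v') \<in> E"
    "\<And>v v'. v \<in> A - T \<Longrightarrow> (v, \<alpha> v, v') \<in> E \<Longrightarrow> v' \<in> A \<and> rk v' < rk v"
    "verts (trap (verts E - A) E) = verts E - A" "closed_arena (trap (verts E - A) E)"
    "all_win wt p (trap (verts E - A) E)"
    "even m \<and> T = {v \<in> verts E. p v = m} \<or>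
     verts (region T E) = T \<and> closed_arena (region T E) \<and> all_win wt p (region T E) \<and> m \<notin> p ` T"
proof -
  define m where "m = Min (p ` verts E)"
  have m: "m \<le> p v" if "v \<in> verts E" for v using fin that by (simp add: m_def)
  have m': "m \<in> p ` verts E" unfolding m_def using fin ne by (intro Min_in) auto
  let ?\<Phi> = "\<lambda>\<pi>. energy_parity p \<pi> \<and> (\<forall>k. p (fst (\<pi> k)) \<noteq> m)"
  let ?Z = "{v. \<exists>c. wins (energy_arena id wt E) ?\<Phi> (v, c)}"
  have "\<exists>T. T \<noteq> {} \<and> T \<subseteq> verts E \<and> (even m \<and> T = {v \<in> verts E. p v = m} \<or>
     verts (region T E) = T \<and> closed_arena (region T E) \<and> all_win wt p (region T E) \<and> m \<notin> p ` T)"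
  proof (cases "even m")
    case True
    then show ?thesis using m' by (intro exI[of _ "{v \<in> verts E. p v = m}"]) auto
  next
    case False
    define Z where "Z = ?Z"
    note r = region_wins[OF Z_def]
    have 1: "Z \<noteq> {}" using wins_avoiding_odd[OF H ne m False] unfolding Z_def by blast
    have 2: "Z \<subseteq> verts E"
    proof -
      have "verts (region Z E) \<subseteq> verts E" unfolding verts_def region_def by force
      then show ?thesis unfolding r(1) .
    qed
    have 3: "all_win wt p (region Z E)"
      unfolding all_win_def r(1)
    proof
      fix v assume "v \<in> Z"
      then obtain c where "wins (energy_arena id wt E) ?\<Phi> (v, c)" unfolding Z_def by blast
      from wins_mono[OF r(3)[OF this], of "energy_parity p"]
      show "\<exists>c. wins (energy_arena id wt (region Z E)) (energy_parity p) (v, c)" by blast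
    qed
    have 4: "m \<notin> p ` Z"
    proof
      assume "m \<in> p ` Z"
      then obtain v c where v: "m = p v" "wins (energy_arena id wt E) ?\<Phi> (v, c)" unfolding Z_def by blast
      then obtain act :: "('v \<times> int) list \<Rightarrow> 'a" and nx Inv x where
        M: "machine (energy_arena id wt E) ?\<Phi> act nx Inv" and I: "Inv x (v, c)"
        unfolding wins_def by blast
      obtain \<pi> where "\<pi> 0 = (v, c)" "?\<Phi> \<pi>" using machine_path[OF M I] .
      then show False using v(1) by (metis fst_conv)
    qed
    have "Z \<noteq> {} \<and> Z \<subseteq> verts E \<and> verts (region Z E) = Z \<and> closed_arena (region Z E) \<and>
        all_win wt p (region Z E) \<and> m \<notin> p ` Z"
      using 1 2 3 4 r(1,2) by (intro conjI)
    then show ?thesis by (intro exI[of _ Z] conjI disjI2) simp_all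
  qed
  then obtain T where T: "T \<noteq> {}" "T \<subseteq> verts E" and c: "even m \<and> T = {v \<in> verts E. p v = m} \<or>
     verts (region T E) = T \<and> closed_arena (region T E) \<and> all_win wt p (region T E) \<and> m \<notin> p ` T"
    by (elim exE conjE)
  obtain A rk \<alpha> where A: "T \<subseteq> A" "A \<subseteq> verts E"
    "\<And>v. v \<in> A \<Longrightarrow> rk v + card T \<le> card A"
    "\<And>v. v \<in> A - T \<Longrightarrow> \<exists>v'. (v, \<alpha> v, v') \<in> E"
    "\<And>v v'. v \<in> A - T \<Longrightarrow> (v, \<alpha> v, v') \<in> E \<Longrightarrow> v' \<in> A \<and> rk v' < rk v"
    "\<And>v a v'. v \<in> verts E - A \<Longrightarrow> (v, a, v') \<in> E \<Longrightarrow> \<exists>v''\<in>verts E - A. (v, a, v'') \<in> E"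
    using that by (rule attractor[OF fin cl T(2)])
  have X: "verts E - A \<subseteq> verts E" by blast
  show ?thesis
    using that[OF m m' T(1) A(1-5) trap_all_win[OF X A(6) H] c] .
qed

definition positional :: "('v \<Rightarrow> nat) \<Rightarrow> ('v \<times> 'a \<times> 'v) set \<Rightarrow> ('v \<Rightarrow> 'a) \<Rightarrow> bool" where
  "positional p E \<tau> \<longleftrightarrow> (\<forall>v\<in>verts E. \<exists>v'. (v, \<tau> v, v') \<in> E) \<and>
     (\<forall>\<pi>. (\<forall>k. (\<pi> k, \<tau> (\<pi> k), \<pi> (Suc k)) \<in> E) \<longrightarrow> parity p \<pi>)"

text \<open>A play that meets \<open>T\<close> only finitely often also leaves \<open>A\<close> for
  good, because ranks would descend from \<open>A\<close> to \<open>T\<close>; its tail then follows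
  \<open>\<tau>'\<close> in the trap. The remaining plays are left to \<open>inf\<close>.\<close>

lemma positional_glue:
  assumes T: "T \<subseteq> A"
    and att: "\<And>v. v \<in> A - T \<Longrightarrow> \<exists>v'. (v, \<alpha> v, v') \<in> E"
      "\<And>v v'. v \<in> A - T \<Longrightarrow> (v, \<alpha> v, v') \<in> E \<Longrightarrow> v' \<in> A \<and> rk v' < (rk v :: nat)"
    and V: "verts (trap (verts E - A) E) = verts E - A"
    and P: "positional p (trap (verts E - A) E) \<tau>'"
    and tT: "\<And>v. v \<in> T \<Longrightarrow> \<exists>v'. (v, \<tau>T v, v') \<in> E"
    and \<tau>: "\<tau> = (\<lambda>v. if v \<in> T then \<tau>T v else if v \<in> A then \<alpha> v else \<tau>' v)"
    and inf: "\<And>\<pi>. (\<And>k. (\<pi> k, \<tau> (\<pi> k), \<pi> (Suc k)) \<in> E) \<Longrightarrow> (\<And>k. \<exists>j\<ge>k. \<pi> j \<in> T) \<Longrightarrow> parity p \<pi>"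
  shows "positional p E \<tau>"
  unfolding positional_def
proof (intro conjI ballI allI impI)
  fix v assume v: "v \<in> verts E"
  have "\<exists>v'. (v, \<tau>' v, v') \<in> E" if "v \<notin> A"
  proof -
    have "v \<in> verts (trap (verts E - A) E)" using v that V by blast
    then obtain v' where "(v, \<tau>' v, v') \<in> trap (verts E - A) E" using P unfolding positional_def by blast
    then show ?thesis by (auto simp: trap_def)
  qed
  then show "\<exists>v'. (v, \<tau> v, v') \<in> E" using att(1) tT by (simp add: \<tau>)
next
  fix \<pi> assume e: "\<forall>k. (\<pi> k, \<tau> (\<pi> k), \<pi> (Suc k)) \<in> E"
  show "parity p \<pi>"
  proof (cases "\<forall>k. \<exists>j\<ge>k. \<pi> j \<in> T")
    case True
    with inf e show ?thesis by blast
  next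
    case False
    then obtain k0 where k0: "\<And>j. j \<ge> k0 \<Longrightarrow> \<pi> j \<notin> T" by blast
    have nA: "\<pi> j \<notin> A" if "j \<ge> k0" for j
      using that
    proof (induction "rk (\<pi> j)" arbitrary: j rule: less_induct)
      case less
      show ?case
      proof
        assume a: "\<pi> j \<in> A"
        then have "\<pi> (Suc j) \<in> A \<and> rk (\<pi> (Suc j)) < rk (\<pi> j)"
          using att(2)[of "\<pi> j" "\<pi> (Suc j)"] e[rule_format, of j] k0[OF less.prems] by (simp add: \<tau>)
        then show False using less.hyps[of "Suc j"] less.prems by simp
      qed
    qed
    have "(\<pi> (k0 + k), \<tau>' (\<pi> (k0 + k)), \<pi> (k0 + Suc k)) \<in> trap (verts E - A) E" for k
    proof -
      have "\<pi> j \<in> verts E" for j using e verts_iff by metis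
      then show ?thesis
        using e[rule_format, of "k0 + k"] nA[of "k0 + k"] nA[of "k0 + Suc k"] k0[of "k0 + k"]
        by (auto simp: trap_def \<tau>)
    qed
    then have "parity p (\<lambda>k. \<pi> (k0 + k))" using P unfolding positional_def by simp
    then show ?thesis by (rule parity_suffix)
  qed
qed

text \<open>For even \<open>m\<close>, recurring visits of \<open>T\<close> settle parity, so any
  action will do there; for odd \<open>m\<close>, a play that has entered \<open>T\<close> never
  leaves it. The intended vertices are pairs of a vertex and a truncated energy, so that this energy
  becomes the only memory.\<close>

lemma positional_exists:
  fixes E :: "('v \<times> 'a \<times> 'v) set"
  assumes "finite (verts E)" "closed_arena E" "all_win wt p E"
  shows "\<exists>\<tau>. positional p E \<tau>"
  using assms
proof (induction "card (verts E)" arbitrary: E rule: less_induct)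
  case less
  show ?case
  proof (cases "verts E = {}")
    case True
    then have "E = {}" by (auto simp: verts_def)
    then have "positional p E \<tau>" for \<tau> by (simp add: positional_def verts_def)
    then show ?thesis by blast
  next
    case False
    obtain m T A rk \<alpha> where D: "\<And>v. v \<in> verts E \<Longrightarrow> m \<le> p v" "m \<in> p ` verts E"
      "T \<noteq> {}" "T \<subseteq> A" "A \<subseteq> verts E"
      "\<And>v. v \<in> A \<Longrightarrow> rk v + card T \<le> card A"
      "\<And>v. v \<in> A - T \<Longrightarrow> \<exists>v'. (v, \<alpha> v, v') \<in> E"
      "\<And>v v'. v \<in> A - T \<Longrightarrow> (v, \<alpha> v, v') \<in> E \<Longrightarrow> v' \<in> A \<and> rk v' < rk v"
      "verts (trap (verts E - A) E) = verts E - A" "closed_arena (trap (verts E - A) E)"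
      "all_win wt p (trap (verts E - A) E)"
      "even m \<and> T = {v \<in> verts E. p v = m} \<or>
       verts (region T E) = T \<and> closed_arena (region T E) \<and> all_win wt p (region T E) \<and> m \<notin> p ` T"
      using that by (rule decomposition[OF less.prems False])
    have "verts E - A \<subset> verts E" using D(3-5) by blast
    then have "card (verts E - A) < card (verts E)"
      by (rule psubset_card_mono[OF less.prems(1)])
    then have "card (verts (trap (verts E - A) E)) < card (verts E)" unfolding D(9) .
    moreover have "finite (verts (trap (verts E - A) E))" unfolding D(9) using less.prems(1) by simp
    ultimately have "\<exists>\<tau>. positional p (trap (verts E - A) E) \<tau>"
      using D(10,11) by (rule less.hyps)
    then obtain \<tau>' where P: "positional p (trap (verts E - A) E) \<tau>'" by blast
    from D(12) show ?thesis
    proof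
      assume ev: "even m \<and> T = {v \<in> verts E. p v = m}"
      have "\<forall>v\<in>T. \<exists>a. \<exists>v'. (v, a, v') \<in> E" using ev by (auto simp: verts_iff)
      then obtain \<tau>T where tT: "\<And>v. v \<in> T \<Longrightarrow> \<exists>v'. (v, \<tau>T v, v') \<in> E" by metis
      define \<tau> where "\<tau> = (\<lambda>v. if v \<in> T then \<tau>T v else if v \<in> A then \<alpha> v else \<tau>' v)"
      have "positional p E \<tau>"
      proof (rule positional_glue[OF D(4,7,8,9) P tT \<tau>_def])
        fix \<pi> assume e: "\<And>k. (\<pi> k, \<tau> (\<pi> k), \<pi> (Suc k)) \<in> E"
          and i: "\<And>k. \<exists>j\<ge>k. \<pi> j \<in> T"
        have "m \<le> p (\<pi> k)" for k using e[of k] D(1)[of "\<pi> k"] verts_iff by metis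
        moreover have "\<exists>j\<ge>k. p (\<pi> j) = m" for k using i[of k] ev by auto
        ultimately show "parity p \<pi>" unfolding parity_def using ev by blast
      qed auto
      then show ?thesis by blast
    next
      assume od: "verts (region T E) = T \<and> closed_arena (region T E) \<and> all_win wt p (region T E) \<and> m \<notin> p ` T"
      have "card T < card (verts E)"
        using D(2,4,5) od less.prems(1) by (intro psubset_card_mono) auto
      moreover have "finite T" using D(4,5) less.prems(1) by (meson finite_subset)
      ultimately have "\<exists>\<tau>. positional p (region T E) \<tau>"
        using od by (intro less.hyps) simp_all
      then obtain \<tau>T where PT: "positional p (region T E) \<tau>T" by blast
      have ex: "\<exists>u. (v, \<tau>T v, u) \<in> region T E" if "v \<in> T" for v
        using PT od that unfolding positional_def by metis
      \<comment> \<open>\<open>region\<close> keeps an action with all its successors or drops it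
        altogether.\<close>
      have ed: "(v, \<tau>T v, v') \<in> region T E \<longleftrightarrow> (v, \<tau>T v, v') \<in> E" if "v \<in> T" for v v'
        using ex[OF that] by (auto simp: region_def)
      have tT: "\<exists>v'. (v, \<tau>T v, v') \<in> E" if "v \<in> T" for v
        using ex[OF that] ed[OF that] by blast
      define \<tau> where "\<tau> = (\<lambda>v. if v \<in> T then \<tau>T v else if v \<in> A then \<alpha> v else \<tau>' v)"
      have "positional p E \<tau>"
      proof (rule positional_glue[OF D(4,7,8,9) P tT \<tau>_def])
        fix \<pi> assume e: "\<And>k. (\<pi> k, \<tau> (\<pi> k), \<pi> (Suc k)) \<in> E"
          and i: "\<And>k. \<exists>j\<ge>k. \<pi> j \<in> T"
        obtain j where j: "\<pi> j \<in> T" using i by blast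
        have sT: "(\<pi> k, \<tau>T (\<pi> k), \<pi> (Suc k)) \<in> region T E" if "\<pi> k \<in> T" for k
          using e[of k] ed that by (simp add: \<tau>_def)
        have st: "\<pi> (j + k) \<in> T" for k
        proof (induction k)
          case (Suc k)
          from sT[OF this] show ?case by (auto simp: region_def)
        qed (simp add: j)
        have "parity p (\<lambda>k. \<pi> (j + k))"
          using PT sT[OF st] unfolding positional_def by simp
        then show "parity p \<pi>" by (rule parity_suffix)
      qed auto
      then show ?thesis by blast
    qed
  qed
qed

section \<open>Bounded energy\<close>

text \<open>Memory of the combined strategy. The level is the energy that the component strategy believes to
  have; the true energy is at least this level in \<open>Run1\<close>, and exceeds it by \<open>off\<close> in \<open>Run2\<close>, which
  pays for the way through the attractor.\<close>

datatype ('x, 'y, 'v) mode = Run1 (mem1: 'x) 'v (level: int) | Run2 (mem2: 'y) 'v (level: int) | Att 'v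

text \<open>One construction for both parities. If the least priority is even, \<open>M1\<close>
  plays the untruncated game on all of \<open>E\<close> and is abandoned at level \<open>L\<close>;
  if it is odd, \<open>M1\<close> plays the truncated game in \<open>region T E\<close>, where
  \<open>L = Cap + 1\<close> is never reached. \<open>req v\<close> is the energy that suffices to
  enter a component at \<open>v\<close>. The first conclusion starts by entering, the second in the
  midst of \<open>M1\<close>.\<close>

lemma capped_glue:
  fixes E :: "('v \<times> 'a \<times> 'v) set" and B Cap Cap2 L off c1 c2 :: int
    and act1 :: "'x \<Rightarrow> 'a" and act2 :: "'y \<Rightarrow> 'a"
  assumes cl: "closed_arena E" and B: "0 \<le> B"
    and bd: "\<And>v a v'. (v, a, v') \<in> E \<Longrightarrow> \<bar>wt v a v'\<bar> \<le> B"
    and T: "T \<subseteq> A" "A \<subseteq> verts E"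
    and att: "\<And>v. v \<in> A - T \<Longrightarrow> \<exists>v'. (v, \<alpha> v, v') \<in> E"
      "\<And>v v'. v \<in> A - T \<Longrightarrow> (v, \<alpha> v, v') \<in> E \<Longrightarrow> v' \<in> A \<and> rk v' < (rk v :: nat)"
    and V: "verts (trap (verts E - A) E) = verts E - A"
    and E1: "E1 \<subseteq> E" "\<And>v a v' v''. (v, a, v') \<in> E1 \<Longrightarrow> (v, a, v'') \<in> E \<Longrightarrow> (v, a, v'') \<in> E1"
    and \<kappa>: "\<And>z. \<kappa> z \<le> z"
    and M1: "machine (energy_arena \<kappa> wt E1) (energy_parity p) act1 nx1 Inv1"
    and I1: "\<And>v. v \<in> T \<Longrightarrow> Inv1 (i1 v) (v, c1)"
    and M2: "machine (energy_arena (min Cap2) wt (trap (verts E - A) E)) (energy_parity p) act2 nx2 Inv2"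
    and I2: "\<And>v. v \<in> verts E - A \<Longrightarrow> Inv2 (i2 v) (v, c2)"
    and req: "\<And>v. req v = (if v \<in> A then c1 + int (rk v) * B else c2 + off)"
    and lim: "\<And>v. v \<in> verts E \<Longrightarrow> req v \<le> L" "\<And>v. v \<in> verts E \<Longrightarrow> req v \<le> Cap"
    and L: "L \<le> Cap + 1"
    and off: "\<And>v. v \<in> A \<Longrightarrow> req v \<le> off - B" "Cap2 + off \<le> Cap" "0 \<le> c1" "0 \<le> off"
    and fin: "(\<forall>\<pi>. (\<forall>k. \<pi> k \<in> verts E) \<longrightarrow> (\<forall>k. \<exists>j\<ge>k. \<pi> j \<in> T) \<longrightarrow> parity p \<pi>) \<or> (\<forall>z. \<kappa> z < L)"
  shows "\<And>v e. v \<in> verts E \<Longrightarrow> req v \<le> e \<Longrightarrow> wins (energy_arena (min Cap) wt E) (energy_parity p) (v, e)"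
    and "\<And>x v e. Inv1 x (v, e) \<Longrightarrow> wins (energy_arena (min Cap) wt E) (energy_parity p) (v, e)"
proof -
  let ?E = "energy_arena (min Cap) wt E"
  define enter :: "'v \<Rightarrow> ('x, 'y, 'v) mode" where
    "enter v = (if v \<in> T then Run1 (i1 v) v c1 else if v \<in> A then Att v else Run2 (i2 v) v c2)" for v
  define act where "act s = (case s of Run1 x v l \<Rightarrow> act1 x | Run2 y v l \<Rightarrow> act2 y | Att v \<Rightarrow> \<alpha> v)"
    for s :: "('x, 'y, 'v) mode"
  define l1 where "l1 x v l v' = \<kappa> (l + wt v (act1 x) v')" for x v l v'
  define l2 where "l2 y v l v' = min Cap2 (l + wt v (act2 y) v')" for y v l v'
  define nx :: "('x, 'y, 'v) mode \<Rightarrow> 'v \<times> int \<Rightarrow> ('x, 'y, 'v) mode" where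
    "nx s n = (case s of
      Run1 x v l \<Rightarrow> if l1 x v l (fst n) < L
        then Run1 (nx1 x (fst n, l1 x v l (fst n))) (fst n) (l1 x v l (fst n)) else enter (fst n)
    | Run2 y v l \<Rightarrow> if fst n \<in> A then enter (fst n)
        else Run2 (nx2 y (fst n, l2 y v l (fst n))) (fst n) (l2 y v l (fst n))
    | Att v \<Rightarrow> enter (fst n))" for s n
  define Inv :: "('x, 'y, 'v) mode \<Rightarrow> 'v \<times> int \<Rightarrow> bool" where
    "Inv s n = (case s of
      Run1 x v l \<Rightarrow> fst n = v \<and> Inv1 x (v, l) \<and> l \<le> snd n
    | Run2 y v l \<Rightarrow> fst n = v \<and> Inv2 y (v, l) \<and> l + off \<le> snd n
    | Att v \<Rightarrow> fst n = v \<and> v \<in> A - T \<and> req v \<le> snd n)" for s n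
  have reqT: "c1 \<le> req v" if "v \<in> A" for v using that B by (simp add: req)
  have reqA: "0 \<le> req v" if "v \<in> A" for v using reqT[OF that] off(3) by simp
  have enterI: "Inv (enter v) (v, e)" if "v \<in> verts E" "req v \<le> e" for v e
  proof -
    have "c1 \<le> e" if "v \<in> A" using reqT[OF that] \<open>req v \<le> e\<close> by simp
    moreover have "c2 + off \<le> e" if "v \<notin> A" using that \<open>req v \<le> e\<close> by (simp add: req)
    ultimately show ?thesis
      using that I1[of v] I2[of v] T(1) by (auto simp: Inv_def enter_def)
  qed
  have av1: "(v, act1 x, v') \<in> E1 \<longleftrightarrow> (v, act1 x, v') \<in> E" if "Inv1 x (v, l)" for x v l v'
    using machineD(1)[OF M1 that] E1 by (auto simp: energy_arena_iff')
  have inX: "v \<in> verts E - A" if i: "Inv2 y (v, l)" for y v l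
  proof -
    obtain n' where "((v, l), act2 y, n') \<in> energy_arena (min Cap2) wt (trap (verts E - A) E)"
      using machineD(1)[OF M2 i] by blast
    then have "v \<in> verts (trap (verts E - A) E)" by (auto simp: energy_arena_iff' verts_iff)
    then show ?thesis using V by simp
  qed
  have av2: "(v, act2 y, v') \<in> trap (verts E - A) E \<longleftrightarrow> (v, act2 y, v') \<in> E \<and> v' \<notin> A"
    if "Inv2 y (v, l)" for y v l v'
    using inX[OF that] cl by (auto simp: trap_def closed_arena_def)
  have "machine ?E (energy_parity p) act nx Inv"
  proof (rule machineI)
    fix s n assume s: "Inv s n"
    have "\<exists>v'. (fst n, act s, v') \<in> E"
    proof (cases s)
      case (Run1 x v l)
      then show ?thesis using s machineD(1)[OF M1, of x "(v, l)"] E1(1)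
        by (auto simp: Inv_def act_def energy_arena_iff')
    next
      case (Run2 y v l)
      then show ?thesis using s machineD(1)[OF M2, of y "(v, l)"]
        by (auto simp: Inv_def act_def energy_arena_iff' trap_def)
    next
      case (Att v)
      then show ?thesis using s att(1) by (auto simp: Inv_def act_def)
    qed
    then show "\<exists>n'. (n, act s, n') \<in> ?E"
      by (auto simp: energy_arena_iff')
  next
    fix s n n' assume s: "Inv s n" and e: "(n, act s, n') \<in> ?E"
    let ?w = "wt (fst n) (act s) (fst n')"
    have e1: "(fst n, act s, fst n') \<in> E" and e2: "snd n' = min Cap (snd n + ?w)"
      using e by (auto simp: energy_arena_iff')
    have w: "- B \<le> ?w" "?w \<le> B" using bd[OF e1] by auto
    have v': "fst n' \<in> verts E" using e1 cl unfolding closed_arena_def by blast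
    have ent: "Inv (enter (fst n')) n'" if "req (fst n') \<le> snd n'"
      using enterI[OF v' that] by simp
    show "Inv (nx s n') n'"
    proof (cases s)
      case (Run1 x v l)
      then have i: "fst n = v" "Inv1 x (v, l)" "l \<le> snd n" using s by (auto simp: Inv_def)
      have a: "act s = act1 x" using Run1 by (simp add: act_def)
      let ?l = "l1 x v l (fst n')"
      have le: "?l \<le> snd n + ?w" using \<kappa>[of "l + ?w"] i a by (simp add: l1_def)
      have "((v, l), act1 x, (fst n', ?l)) \<in> energy_arena \<kappa> wt E1"
        using e1 av1[OF i(2)] i(1) a by (simp add: energy_arena_iff l1_def)
      then have J: "Inv1 (nx1 x (fst n', ?l)) (fst n', ?l)" using machineD(2)[OF M1 i(2)] by blast
      show ?thesis
      \<comment> \<open>By \<open>L \<le> Cap + 1\<close>, a level below \<open>L\<close> is at most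
        \<open>Cap\<close>, so truncation does not push the true energy below it. A level of at
        least \<open>L\<close> pays for entering at any vertex.\<close>
      proof (cases "?l < L")
        case True
        then show ?thesis using Run1 J le e2 L by (simp add: nx_def Inv_def)
      next
        case False
        then have "req (fst n') \<le> snd n'" using lim[OF v'] le e2 by simp
        then show ?thesis using Run1 False ent by (simp add: nx_def)
      qed
    next
      case (Run2 y v l)
      then have i: "fst n = v" "Inv2 y (v, l)" "l + off \<le> snd n" using s by (auto simp: Inv_def)
      have a: "act s = act2 y" using Run2 by (simp add: act_def)
      let ?l = "l2 y v l (fst n')"
      show ?thesis
      proof (cases "fst n' \<in> A")
        case True
        \<comment> \<open>Before the step the true energy is at least \<open>off\<close>, so at
          least \<open>off - B\<close> is left for the way through \<open>A\<close>, up to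
          truncation at \<open>Cap\<close>.\<close>
        have "0 \<le> l" using energy_machine_nonneg[OF M2 i(2)] .
        then have "req (fst n') \<le> snd n'"
          using off(1)[OF True] lim(2)[OF v'] e2 w i(3) by simp
        then show ?thesis using Run2 True ent by (simp add: nx_def)
      next
        case False
        have "((v, l), act2 y, (fst n', ?l)) \<in> energy_arena (min Cap2) wt (trap (verts E - A) E)"
          using e1 av2[OF i(2)] i(1) a False by (simp add: energy_arena_iff l2_def)
        then have J: "Inv2 (nx2 y (fst n', ?l)) (fst n', ?l)" using machineD(2)[OF M2 i(2)] by blast
        \<comment> \<open>A level capped at \<open>Cap2\<close> stays within \<open>Cap\<close>
          after adding \<open>off\<close>, so the two truncations are compatible.\<close>
        have "?l + off \<le> snd n'" using e2 i a off(2) by (simp add: l2_def min_def)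
        then show ?thesis using Run2 False J by (simp add: nx_def Inv_def)
      qed
    next
      case (Att v)
      then have i: "fst n = v" "v \<in> A - T" "req v \<le> snd n" using s by (auto simp: Inv_def)
      have r: "fst n' \<in> A" "rk (fst n') < rk v"
        using att(2)[OF i(2), of "fst n'"] e1 i(1) Att by (auto simp: act_def)
      \<comment> \<open>Each rank descended frees \<open>B\<close>, the price of one edge.\<close>
      have "int (rk (fst n')) * B + B \<le> int (rk v) * B"
        using mult_right_mono[of "int (rk (fst n')) + 1" "int (rk v)" B] r(2) B
        by (simp add: algebra_simps)
      then have "req (fst n') + B \<le> req v" using r(1) i(2) by (simp add: req)
      then have "req (fst n') \<le> snd n'" using i(3) w e2 lim(2)[OF v'] by simp
      then show ?thesis using Att ent by (simp add: nx_def)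
    qed
  next
    fix \<xi> \<pi> assume I: "\<And>k. Inv (\<xi> k) (\<pi> k)" and e: "\<And>k. (\<pi> k, act (\<xi> k), \<pi> (Suc k)) \<in> ?E"
      and n: "\<And>k. \<xi> (Suc k) = nx (\<xi> k) (\<pi> (Suc k))"
    let ?v = "\<lambda>k. fst (\<pi> k)"
    have eE: "(?v k, act (\<xi> k), ?v (Suc k)) \<in> E" for k using e[of k] by (simp add: energy_arena_iff')
    have pos: "0 \<le> snd (\<pi> k)" for k
    proof (cases "\<xi> k")
      case (Run1 x v l)
      then show ?thesis using I[of k] energy_machine_nonneg[OF M1, of x v l] by (simp add: Inv_def)
    next
      case (Run2 y v l)
      then show ?thesis using I[of k] energy_machine_nonneg[OF M2, of y v l] off(4) by (simp add: Inv_def)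
    next
      case (Att v)
      then show ?thesis using I[of k] reqA[of v] by (simp add: Inv_def)
    qed
    have chain1: "parity p ?v" if c: "\<And>j. k0 \<le> j \<Longrightarrow> \<exists>x l. \<xi> j = Run1 x (?v j) l \<and>
        \<xi> (Suc j) = Run1 (nx1 x (?v (Suc j), l1 x (?v j) l (?v (Suc j)))) (?v (Suc j)) (l1 x (?v j) l (?v (Suc j)))" for k0
    proof -
      have "energy_parity p (\<lambda>i. (?v (k0 + i), level (\<xi> (k0 + i))))"
      proof (rule machineD(3)[OF M1, of "\<lambda>i. mem1 (\<xi> (k0 + i))"])
        fix i
        obtain x l where c': "\<xi> (k0 + i) = Run1 x (?v (k0 + i)) l"
          "\<xi> (Suc (k0 + i)) = Run1 (nx1 x (?v (Suc (k0 + i)), l1 x (?v (k0 + i)) l (?v (Suc (k0 + i)))))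
             (?v (Suc (k0 + i))) (l1 x (?v (k0 + i)) l (?v (Suc (k0 + i))))"
          using c[of "k0 + i"] by auto
        have i1: "Inv1 x (?v (k0 + i), l)" using I[of "k0 + i"] c'(1) by (simp add: Inv_def)
        then show "Inv1 (mem1 (\<xi> (k0 + i))) (?v (k0 + i), level (\<xi> (k0 + i)))" using c'(1) by simp
        show "((?v (k0 + i), level (\<xi> (k0 + i))), act1 (mem1 (\<xi> (k0 + i))),
            (?v (k0 + Suc i), level (\<xi> (k0 + Suc i)))) \<in> energy_arena \<kappa> wt E1"
          using c' av1[OF i1] eE[of "k0 + i"] by (simp add: energy_arena_iff act_def l1_def)
        show "mem1 (\<xi> (k0 + Suc i)) = nx1 (mem1 (\<xi> (k0 + i))) (?v (k0 + Suc i), level (\<xi> (k0 + Suc i)))"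
          using c' by simp
      qed
      then show ?thesis unfolding energy_parity_def by (auto intro: parity_suffix[of p ?v k0])
    qed
    have chain2: "parity p ?v" if c: "\<And>j. k0 \<le> j \<Longrightarrow> \<exists>y l. \<xi> j = Run2 y (?v j) l" for k0
    proof -
      have "energy_parity p (\<lambda>i. (?v (k0 + i), level (\<xi> (k0 + i))))"
      proof (rule machineD(3)[OF M2, of "\<lambda>i. mem2 (\<xi> (k0 + i))"])
        fix i
        obtain y l where c1: "\<xi> (k0 + i) = Run2 y (?v (k0 + i)) l" using c[of "k0 + i"] by auto
        obtain y' l' where c2: "\<xi> (Suc (k0 + i)) = Run2 y' (?v (Suc (k0 + i))) l'" using c[of "Suc (k0 + i)"] by auto
        have i2: "Inv2 y (?v (k0 + i), l)" using I[of "k0 + i"] c1 by (simp add: Inv_def)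
        then show "Inv2 (mem2 (\<xi> (k0 + i))) (?v (k0 + i), level (\<xi> (k0 + i)))" using c1 by simp
        have "Inv2 y' (?v (Suc (k0 + i)), l')" using I[of "Suc (k0 + i)"] c2 by (simp add: Inv_def)
        from inX[OF this] have nA: "?v (Suc (k0 + i)) \<notin> A" by simp
        have c3: "\<xi> (Suc (k0 + i)) = Run2 (nx2 y (?v (Suc (k0 + i)), l2 y (?v (k0 + i)) l (?v (Suc (k0 + i)))))
             (?v (Suc (k0 + i))) (l2 y (?v (k0 + i)) l (?v (Suc (k0 + i))))"
          using n[of "k0 + i"] c1 nA by (simp add: nx_def)
        show "((?v (k0 + i), level (\<xi> (k0 + i))), act2 (mem2 (\<xi> (k0 + i))),
            (?v (k0 + Suc i), level (\<xi> (k0 + Suc i)))) \<in> energy_arena (min Cap2) wt (trap (verts E - A) E)"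
          using c1 c3 nA av2[OF i2] eE[of "k0 + i"] by (simp add: energy_arena_iff act_def l2_def)
        show "mem2 (\<xi> (k0 + Suc i)) = nx2 (mem2 (\<xi> (k0 + i))) (?v (k0 + Suc i), level (\<xi> (k0 + Suc i)))"
          using c1 c3 by simp
      qed
      then show ?thesis unfolding energy_parity_def by (auto intro: parity_suffix[of p ?v k0])
    qed
    \<comment> \<open>If \<open>R\<close> holds only finitely often, then \<open>Att\<close>
      eventually disappears, as falling ranks would lead to \<open>Run1\<close> on \<open>T\<close>.
      The play then stays in \<open>Run1\<close> or in \<open>Run2\<close> forever, and a single
      component machine settles parity.\<close>
    define R where "R k \<longleftrightarrow> (\<exists>x l. \<xi> k = Run1 x (?v k) l) \<and> ?v k \<in> T" for k
    have "parity p ?v"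
    proof (cases "\<forall>k. \<exists>j\<ge>k. R j")
      case True
      from fin show ?thesis
      proof
        assume "\<forall>\<pi>. (\<forall>k. \<pi> k \<in> verts E) \<longrightarrow> (\<forall>k. \<exists>j\<ge>k. \<pi> j \<in> T) \<longrightarrow> parity p \<pi>"
        moreover have "?v k \<in> verts E" for k using eE[of k] verts_iff by metis
        moreover have "\<exists>j\<ge>k. ?v j \<in> T" for k using True unfolding R_def by blast
        ultimately show ?thesis by simp
      next
        assume ns: "\<forall>z. \<kappa> z < L"
        obtain k0 x l where k0: "\<xi> k0 = Run1 x (?v k0) l" using True unfolding R_def by blast
        have r: "\<xi> (Suc j) = Run1 (nx1 x (?v (Suc j), l1 x (?v j) l (?v (Suc j)))) (?v (Suc j)) (l1 x (?v j) l (?v (Suc j)))"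
          if "\<xi> j = Run1 x (?v j) l" for j x l
          using n[of j] that ns by (simp add: nx_def l1_def)
        have "\<exists>x l. \<xi> j = Run1 x (?v j) l" if "k0 \<le> j" for j
          using that by (induction rule: dec_induct) (use k0 r in blast)+
        then show ?thesis using r by (intro chain1[of k0]) blast
      qed
    next
      case False
      then obtain k0 where k0: "\<And>j. k0 \<le> j \<Longrightarrow> \<not> R j" by blast
      have nT: "?v (Suc j) \<notin> T" if "k0 \<le> j" "\<xi> (Suc j) = enter (?v (Suc j))" for j
        using k0[of "Suc j"] that unfolding R_def by (auto simp: enter_def)
      have nAtt: "\<xi> j \<noteq> Att v" if "k0 \<le> j" for j v
        using that
      proof (induction "rk v" arbitrary: j v rule: less_induct)
        case less
        show ?case
        proof
          assume a: "\<xi> j = Att v"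
          then have i: "?v j = v" "v \<in> A - T" using I[of j] by (auto simp: Inv_def)
          have s: "?v (Suc j) \<in> A" "rk (?v (Suc j)) < rk v"
            using att(2)[OF i(2), of "?v (Suc j)"] eE[of j] i(1) a by (auto simp: act_def)
          have en: "\<xi> (Suc j) = enter (?v (Suc j))" using n[of j] a by (simp add: nx_def)
          then have "\<xi> (Suc j) = Att (?v (Suc j))" using nT[OF less.prems en] s(1) by (simp add: enter_def)
          then show False using less.hyps[OF s(2), of "Suc j"] less.prems by simp
        qed
      qed
      have run2: "\<exists>y l. \<xi> (Suc j) = Run2 y (?v (Suc j)) l"
        if "k0 \<le> j" "\<xi> (Suc j) = enter (?v (Suc j))" for j
        using nT[OF that] nAtt[of "Suc j" "?v (Suc j)"] that by (auto simp: enter_def split: if_splits)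
      show ?thesis
      proof (cases "\<exists>k1\<ge>k0. \<exists>y l. \<xi> k1 = Run2 y (?v k1) l")
        case True
        then obtain k1 where k1: "k0 \<le> k1" "\<exists>y l. \<xi> k1 = Run2 y (?v k1) l" by blast
        have "\<exists>y l. \<xi> j = Run2 y (?v j) l" if "k1 \<le> j" for j
          using that
        proof (induction rule: dec_induct)
          case (step j)
          then obtain y l where "\<xi> j = Run2 y (?v j) l" by blast
          then show ?case using n[of j] run2[of j] k1(1) step(1) by (auto simp: nx_def split: if_splits)
        qed (rule k1(2))
        then show ?thesis by (rule chain2)
      next
        case F2: False
        have vv: "\<exists>x l. \<xi> j = Run1 x (?v j) l" if "k0 \<le> j" for j
        proof (cases "\<xi> j")
          case (Run1 x v l) then show ?thesis using I[of j] by (simp add: Inv_def)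
        next
          case (Run2 y v l) then show ?thesis using I[of j] F2 that by (auto simp: Inv_def)
        next
          case (Att v) then show ?thesis using nAtt that by blast
        qed
        show ?thesis
        proof (rule chain1[of k0])
          fix j assume j: "k0 \<le> j"
          then obtain x l where x: "\<xi> j = Run1 x (?v j) l" using vv by blast
          have "\<xi> (Suc j) \<noteq> enter (?v (Suc j))" using run2[OF j] F2 j by (meson le_SucI)
          then show "\<exists>x l. \<xi> j = Run1 x (?v j) l \<and>
            \<xi> (Suc j) = Run1 (nx1 x (?v (Suc j), l1 x (?v j) l (?v (Suc j)))) (?v (Suc j)) (l1 x (?v j) l (?v (Suc j)))"
            using n[of j] x by (auto simp: nx_def split: if_splits)
        qed
      qed
    qed
    with pos show "energy_parity p \<pi>" by (simp add: energy_parity_def)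
  qed
  note mw = machine_wins[OF this]
  show "wins ?E (energy_parity p) (v, e)" if "v \<in> verts E" "req v \<le> e" for v e
    by (rule mw[OF enterI[OF that]])
  show "wins ?E (energy_parity p) (v, e)" if "Inv1 x (v, e)" for x v e
    by (rule mw[of "Run1 x v e"]) (simp add: Inv_def that)
qed

text \<open>The credit \<open>(N - 1) B\<close> is the same as without truncation. For even
  \<open>m\<close> it is the credit of \<open>M1\<close> itself, by \<open>credit_bound\<close>; for
  odd \<open>m\<close> it equals \<open>req\<close> outside \<open>A\<close> and is at least
  \<open>req\<close> on \<open>A\<close>.\<close>

lemma capped_wins:
  fixes E :: "('v \<times> 'a \<times> 'v) set" and B Cap :: int
  assumes "finite (verts E)" "closed_arena E" "all_win wt p E" and B: "1 \<le> B"
    and "\<And>v a v'. (v, a, v') \<in> E \<Longrightarrow> \<bar>wt v a v'\<bar> \<le> B"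
    and "2 * int (card (verts E)) * int (card (p ` verts E)) * B \<le> Cap" and "v \<in> verts E"
  shows "wins (energy_arena (min Cap) wt E) (energy_parity p) (v, (int (card (verts E)) - 1) * B)"
  using assms(1-3,5-)
proof (induction "card (verts E)" arbitrary: E Cap v rule: less_induct)
  case less
  let ?V = "verts E"
  note fin = less.prems(1) and cl = less.prems(2) and bd = less.prems(4)
  have ne: "?V \<noteq> {}" using less.prems(6) by blast
  obtain m T A rk \<alpha> where D: "\<And>v. v \<in> verts E \<Longrightarrow> m \<le> p v" "m \<in> p ` verts E"
    "T \<noteq> {}" "T \<subseteq> A" "A \<subseteq> verts E"
    "\<And>v. v \<in> A \<Longrightarrow> rk v + card T \<le> card A"
    "\<And>v. v \<in> A - T \<Longrightarrow> \<exists>v'. (v, \<alpha> v, v') \<in> E"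
    "\<And>v v'. v \<in> A - T \<Longrightarrow> (v, \<alpha> v, v') \<in> E \<Longrightarrow> v' \<in> A \<and> rk v' < rk v"
    "verts (trap (verts E - A) E) = verts E - A" "closed_arena (trap (verts E - A) E)"
    "all_win wt p (trap (verts E - A) E)"
    "even m \<and> T = {v \<in> verts E. p v = m} \<or>
     verts (region T E) = T \<and> closed_arena (region T E) \<and> all_win wt p (region T E) \<and> m \<notin> p ` T"
    using that by (rule decomposition[OF less.prems(1-3) ne])
  let ?X = "?V - A" and ?E' = "trap (?V - A) E"
  define N t a d d' where "N = int (card ?V)" and "t = int (card T)" and "a = int (card A)"
    and "d = int (card (p ` ?V))" and "d' = int (card (p ` ?X))"
  have finA: "finite A" using D(5) fin by (rule finite_subset)
  have finT: "finite T" using D(4) finA by (rule finite_subset)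
  have t: "1 \<le> t" using finT D(3) by (simp add: t_def Suc_le_eq card_gt_0_iff)
  have ta: "t \<le> a" using D(4) finA by (simp add: t_def a_def card_mono)
  have aN: "a \<le> N" using D(5) fin by (simp add: a_def N_def card_mono)
  have cX: "int (card ?X) = N - a"
    using D(5) fin finA by (simp add: N_def a_def card_Diff_subset card_mono of_nat_diff)
  have d1: "1 \<le> d" using fin ne by (simp add: d_def Suc_le_eq card_gt_0_iff)
  have d': "0 \<le> d'" "d' \<le> d" unfolding d_def d'_def using fin by (auto intro!: card_mono)
  have Cap: "2 * N * d * B \<le> Cap" using less.prems(5) by (simp add: N_def d_def)
  have NB: "N * B \<le> N * d * B" using d1 B aN ta t by (simp add: mult_le_cancel_right mult_le_cancel_left)
  have rkB: "int (rk v) * B \<le> (a - t) * B" if "v \<in> A" for v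
    using D(6)[OF that] B by (intro mult_right_mono) (auto simp: a_def t_def)
  have "card ?X < card ?V" using D(3-5) fin by (intro psubset_card_mono) auto
  moreover have "\<bar>wt v a v'\<bar> \<le> B" if "(v, a, v') \<in> ?E'" for v a v' using bd that by (auto simp: trap_def)
  ultimately have IH: "wins (energy_arena (min Cap2) wt ?E') (energy_parity p) (v, (N - a - 1) * B)"
    if "2 * (N - a) * d' * B \<le> Cap2" "v \<in> ?X" for v Cap2
    using less.hyps[of ?E' Cap2 v] D(9-11) fin that cX by (simp add: d'_def)
  have IHm: "\<exists>(act2 :: ('v \<times> int) \<times> ('v \<times> int) list \<Rightarrow> 'a) nx2 Inv2 i2.
      machine (energy_arena (min Cap2) wt ?E') (energy_parity p) act2 nx2 Inv2 \<and>
      (\<forall>v\<in>?X. Inv2 (i2 v) (v, (N - a - 1) * B))"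
    if c: "2 * (N - a) * d' * B \<le> Cap2" for Cap2
  proof -
    obtain act2 :: "('v \<times> int) \<times> ('v \<times> int) list \<Rightarrow> 'a" and nx2 Inv2 i2 where
      "machine (energy_arena (min Cap2) wt ?E') (energy_parity p) act2 nx2 Inv2"
      "\<And>n. wins (energy_arena (min Cap2) wt ?E') (energy_parity p) n \<Longrightarrow> Inv2 (i2 n) n"
      using wins_uniform by blast
    then show ?thesis using IH[OF c]
      by (intro exI[of _ act2] exI[of _ nx2] exI[of _ Inv2] exI[of _ "\<lambda>v. i2 (v, (N - a - 1) * B)"]) auto
  qed
  from D(12) show ?case
  proof
    assume ev: "even m \<and> T = {v \<in> verts E. p v = m}"
    have "m \<notin> p ` ?X" using ev D(4) by auto
    then have "p ` ?X \<subset> p ` ?V" using D(2) by auto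
    then have dd: "d' \<le> d - 1" unfolding d_def d'_def
      using psubset_card_mono[of "p ` ?V" "p ` ?X"] fin by simp
    \<comment> \<open>Returning to \<open>T\<close> from outside \<open>A\<close> takes one edge
      into \<open>A\<close>, at most \<open>a - t\<close> ranks, and the credit
      \<open>(N - 1) B\<close> needed on \<open>T\<close>: this makes \<open>(N + a - t) B\<close>,
      rounded up here.\<close>
    let ?off = "(N + a) * B"
    have "2 * (N - a) * d' * B \<le> Cap - ?off"
    proof -
      have "2 * (N - a) * d' \<le> 2 * (N - a) * (d - 1)" using dd aN by (intro mult_left_mono) auto
      also have "\<dots> \<le> 2 * N * (d - 1)" using ta t d1 by (intro mult_right_mono) auto
      also have "\<dots> \<le> 2 * N * d - (N + a)" using aN by (simp add: algebra_simps)
      finally have "2 * (N - a) * d' * B \<le> (2 * N * d - (N + a)) * B" using B by (intro mult_right_mono) auto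
      then show ?thesis using Cap by (simp add: algebra_simps)
    qed
    from IHm[OF this] obtain act2 :: "('v \<times> int) \<times> ('v \<times> int) list \<Rightarrow> 'a" and nx2 Inv2 i2 where
      M2: "machine (energy_arena (min (Cap - ?off)) wt ?E') (energy_parity p) act2 nx2 Inv2"
      and I2: "\<And>v. v \<in> ?X \<Longrightarrow> Inv2 (i2 v) (v, (N - a - 1) * B)" by blast
    obtain act1 :: "('v \<times> int) \<times> ('v \<times> int) list \<Rightarrow> 'a" and nx1 Inv1 i1 where
      M1: "machine (energy_arena id wt E) (energy_parity p) act1 nx1 Inv1"
      and I1: "\<And>n. wins (energy_arena id wt E) (energy_parity p) n \<Longrightarrow> Inv1 (i1 n) n"
      using wins_uniform by blast
    have I1': "Inv1 (i1 (v, (N - 1) * B)) (v, (N - 1) * B)" if "v \<in> ?V" for v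
      using I1 credit_bound[OF fin cl less.prems(3) B bd that] by (simp add: N_def)
    define req where "req v = (if v \<in> A then (N - 1) * B + int (rk v) * B else (N - a - 1) * B + ?off)" for v
    \<comment> \<open>This bound becomes the level \<open>L\<close> at which collecting ends;
      outside \<open>A\<close>, \<open>req\<close> is only \<open>B\<close> below it.\<close>
    have r1: "req v \<le> 2 * N * B" for v
    proof (cases "v \<in> A")
      case True
      have "req v \<le> (N - 1) * B + (a - t) * B" using rkB[OF True] True by (simp add: req_def)
      also have "\<dots> = (N - 1 + a - t) * B" by (simp add: algebra_simps)
      also have "\<dots> \<le> 2 * N * B" using aN t B by (intro mult_right_mono) auto
      finally show ?thesis .
    next
      case False
      have "req v = (2 * N - 1) * B" using False by (simp add: req_def algebra_simps)
      then show ?thesis using B by (simp add: algebra_simps)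
    qed
    have NC: "2 * N * B \<le> Cap" using NB Cap by simp
    have "wins (energy_arena (min Cap) wt E) (energy_parity p) (v, (N - 1) * B)"
    proof (rule capped_glue(2)[where T = T and A = A and rk = rk and \<alpha> = \<alpha> and ?E1.0 = E and \<kappa> = id
          and req = req and L = "2 * N * B" and off = ?off and Cap = Cap,
          OF cl _ bd D(4,5,7,8,9) _ _ _ M1 _ M2 I2 req_def])
      show "Inv1 (i1 (v, (N - 1) * B)) (v, (N - 1) * B)" by (rule I1'[OF less.prems(6)])
      show "Inv1 (i1 (v, (N - 1) * B)) (v, (N - 1) * B)" if "v \<in> T" for v
        using I1' that D(4,5) by blast
      show "0 \<le> (N - 1) * B" using ta aN t B by simp
      show "0 \<le> ?off" using ta aN t B by simp
      show "req v \<le> ?off - B" if "v \<in> A" for v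
      proof -
        have "req v \<le> (N - 1) * B + (a - t) * B" using rkB[OF that] that by (simp add: req_def)
        also have "\<dots> = ?off - B - t * B" by (simp add: algebra_simps)
        also have "\<dots> \<le> ?off - B" using t B by simp
        finally show ?thesis .
      qed
      have "parity p \<pi>" if "\<forall>k. \<pi> k \<in> ?V" "\<forall>k. \<exists>j\<ge>k. \<pi> j \<in> T" for \<pi>
        using that ev D(1) unfolding parity_def by (intro exI[of _ m]) auto
      then show "(\<forall>\<pi>. (\<forall>k. \<pi> k \<in> ?V) \<longrightarrow> (\<forall>k. \<exists>j\<ge>k. \<pi> j \<in> T) \<longrightarrow> parity p \<pi>) \<or> (\<forall>z. id z < 2 * N * B)"
        by blast
    qed (use B r1 NC order_trans[OF r1 NC] in auto)
    then show ?case by (simp add: N_def)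
  next
    assume od: "verts (region T E) = T \<and> closed_arena (region T E) \<and> all_win wt p (region T E) \<and> m \<notin> p ` T"
    \<comment> \<open>On \<open>T\<close> the credit \<open>(t - 1) B\<close> suffices, since
      \<open>M1\<close> stays among the \<open>t\<close> vertices of \<open>region T E\<close>. With
      at most \<open>a - t\<close> ranks and one edge into \<open>A\<close> this makes
      \<open>a B\<close>.\<close>
    let ?off = "a * B"
    have "T \<noteq> ?V" using od D(2) by blast
    then have cT: "card T < card ?V" using D(4,5) fin by (intro psubset_card_mono) auto
    have dT: "int (card (p ` T)) \<le> d" unfolding d_def using D(4,5) fin by (auto intro!: card_mono)
    have "2 * t * int (card (p ` T)) \<le> 2 * N * d" using dT ta aN t by (intro mult_mono) auto
    then have "2 * t * int (card (p ` T)) * B \<le> 2 * N * d * B" using B by (intro mult_right_mono) auto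
    then have CT: "2 * t * int (card (p ` T)) * B \<le> Cap" using Cap by simp
    have bdT: "\<bar>wt v a v'\<bar> \<le> B" if "(v, a, v') \<in> region T E" for v a v' using bd that by (auto simp: region_def)
    have wT: "wins (energy_arena (min Cap) wt (region T E)) (energy_parity p) (v, (t - 1) * B)" if "v \<in> T" for v
      using less.hyps[of "region T E" Cap v] od cT finT bdT CT that by (simp add: t_def)
    obtain act1 :: "('v \<times> int) \<times> ('v \<times> int) list \<Rightarrow> 'a" and nx1 Inv1 i1 where
      M1: "machine (energy_arena (min Cap) wt (region T E)) (energy_parity p) act1 nx1 Inv1"
      and I1: "\<And>n. wins (energy_arena (min Cap) wt (region T E)) (energy_parity p) n \<Longrightarrow> Inv1 (i1 n) n"
      using wins_uniform by blast
    have "2 * (N - a) * d' * B \<le> Cap - ?off"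
    proof -
      have "2 * (N - a) * d' \<le> 2 * (N - a) * d" using d' aN by (intro mult_left_mono) auto
      also have "\<dots> = 2 * N * d - 2 * (a * d)" by (simp add: algebra_simps)
      also have "\<dots> \<le> 2 * N * d - a" using mult_left_mono[OF d1, of a] ta t by simp
      finally have "2 * (N - a) * d' * B \<le> (2 * N * d - a) * B" using B by (intro mult_right_mono) auto
      then show ?thesis using Cap by (simp add: algebra_simps)
    qed
    from IHm[OF this] obtain act2 :: "('v \<times> int) \<times> ('v \<times> int) list \<Rightarrow> 'a" and nx2 Inv2 i2 where
      M2: "machine (energy_arena (min (Cap - ?off)) wt ?E') (energy_parity p) act2 nx2 Inv2"
      and I2: "\<And>v. v \<in> ?X \<Longrightarrow> Inv2 (i2 v) (v, (N - a - 1) * B)" by blast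
    define req where "req v = (if v \<in> A then (t - 1) * B + int (rk v) * B else (N - a - 1) * B + ?off)" for v
    have rA: "req v \<le> (a - 1) * B" if "v \<in> A" for v
      using rkB[OF that] that by (simp add: req_def algebra_simps)
    have r1: "req v \<le> (N - 1) * B" for v
    proof (cases "v \<in> A")
      case True
      have "(a - 1) * B \<le> (N - 1) * B" using aN B by (intro mult_right_mono) auto
      with rA[OF True] show ?thesis by simp
    next
      case False
      then show ?thesis by (simp add: req_def algebra_simps)
    qed
    have "(N - 1) * B \<le> 2 * N * B" using ta aN t B by (intro mult_right_mono) auto
    then have NC: "(N - 1) * B \<le> Cap" using NB Cap by simp
    have "wins (energy_arena (min Cap) wt E) (energy_parity p) (v, (N - 1) * B)"
    proof (rule capped_glue(1)[where T = T and A = A and rk = rk and \<alpha> = \<alpha> and ?E1.0 = "region T E" and \<kappa> = "min Cap"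
          and req = req and L = "Cap + 1" and off = ?off and Cap = Cap,
          OF cl _ bd D(4,5,7,8,9) _ _ _ M1 _ M2 I2 req_def])
      show "Inv1 (i1 (v, (t - 1) * B)) (v, (t - 1) * B)" if "v \<in> T" for v
        by (rule I1[OF wT[OF that]])
      show "req v \<le> ?off - B" if "v \<in> A" for v using rA[OF that] by (simp add: algebra_simps)
      show "0 \<le> (t - 1) * B" "0 \<le> ?off" using t ta B by auto
      show "req v \<le> Cap" "req v \<le> Cap + 1" for v using r1[of v] NC by auto
    qed (use B r1 less.prems(6) in \<open>auto simp: region_def\<close>)
    then show ?case by (simp add: N_def)
  qed
qed

text \<open>There are two restrictions. Cutting \<open>E\<close> down to its winning vertices makes
  \<open>capped_wins\<close> applicable; cutting the truncated game down to its winning pairs makes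
  \<open>positional_exists\<close> applicable.\<close>

lemma bounded_positional:
  fixes E :: "('v \<times> 'a \<times> 'v) set" and B Cap :: int
  assumes fin: "finite (verts E)"
    and win: "wins (energy_arena id wt E) (energy_parity p) (v0, c0)" and B: "1 \<le> B"
    and bd: "\<And>v a v'. (v, a, v') \<in> E \<Longrightarrow> \<bar>wt v a v'\<bar> \<le> B"
    and Cap: "2 * int (card (verts E)) * int (card (p ` verts E)) * B \<le> Cap"
  obtains R \<tau> e0 where "R \<subseteq> verts E \<times> {0..Cap}" "(v0, e0) \<in> R"
    "\<And>v e. (v, e) \<in> R \<Longrightarrow> \<exists>v'. (v, \<tau> (v, e), v') \<in> E"
    "\<And>v e v'. (v, e) \<in> R \<Longrightarrow> (v, \<tau> (v, e), v') \<in> E \<Longrightarrow> (v', min Cap (e + wt v (\<tau> (v, e)) v')) \<in> R"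
    "\<forall>\<pi>. (\<forall>k. \<pi> k \<in> R \<and> (\<pi> k, \<tau> (\<pi> k), \<pi> (Suc k)) \<in> energy_arena (min Cap) wt E) \<longrightarrow>
      parity p (\<lambda>k. fst (\<pi> k))"
proof -
  define Z where "Z = {v. \<exists>c. wins (energy_arena id wt E) (energy_parity p) (v, c)}"
  define E1 where "E1 = region Z E"
  note r1 = region_wins[OF Z_def, folded E1_def]
  have sub1: "E1 \<subseteq> E" by (auto simp: E1_def region_def)
  have full1: "(v, a, v'') \<in> E1" if "(v, a, v') \<in> E1" "(v, a, v'') \<in> E" for v a v' v''
    using that by (auto simp: E1_def region_def)
  have V1: "verts E1 \<subseteq> verts E" using sub1 by (auto simp: verts_def)
  have fin1: "finite (verts E1)" using V1 fin by (rule finite_subset)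
  have aw1: "all_win wt p E1"
    unfolding all_win_def r1(1) using r1(3) unfolding Z_def by blast
  have v0: "v0 \<in> verts E1" unfolding r1(1) using win by (auto simp: Z_def)
  define N where "N = int (card (verts E1))"
  have N: "1 \<le> N" "N \<le> int (card (verts E))"
    using v0 fin1 card_mono[OF fin V1] by (auto simp: N_def Suc_le_eq card_gt_0_iff)
  have d: "1 \<le> int (card (p ` verts E1))" "int (card (p ` verts E1)) \<le> int (card (p ` verts E))"
    using v0 fin1 card_mono[OF finite_imageI[OF fin], of "p ` verts E1" p] V1
    by (auto simp: Suc_le_eq card_gt_0_iff)
  have "2 * N * int (card (p ` verts E1)) * B \<le> 2 * int (card (verts E)) * int (card (p ` verts E)) * B"
    using N d B by (intro mult_mono) auto
  then have Cap1: "2 * N * int (card (p ` verts E1)) * B \<le> Cap" using Cap by simp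
  define e0 where "e0 = (N - 1) * B"
  have w1: "wins (energy_arena (min Cap) wt E1) (energy_parity p) (v0, e0)"
    unfolding e0_def N_def
    by (rule capped_wins[OF fin1 r1(2) aw1 B bd Cap1[unfolded N_def] v0]) (use sub1 in auto)
  have "(N - 1) * B \<le> 2 * N * int (card (p ` verts E1)) * B"
  proof (intro mult_right_mono)
    have "N * 1 \<le> N * int (card (p ` verts E1))" using N d by (intro mult_left_mono) auto
    then show "N - 1 \<le> 2 * N * int (card (p ` verts E1))" using N by linarith
  qed (use B in simp)
  then have e0: "e0 \<le> Cap" using Cap1 by (simp add: e0_def)
  \<comment> \<open>Energies become part of the vertices, and their bounds make the vertex set
    finite. What remains is a parity game, expressed as an energy game with the zero weights
    \<open>wt0\<close>.\<close>
  define E2 where "E2 = {(n, a, n'). (n, a, n') \<in> energy_arena (min Cap) wt E1 \<and> 0 \<le> snd n \<and> snd n \<le> Cap}"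
  define wt0 :: "'v \<times> int \<Rightarrow> 'a \<Rightarrow> 'v \<times> int \<Rightarrow> int" where "wt0 = (\<lambda>_ _ _. 0)"
  define p' where "p' = (\<lambda>n :: 'v \<times> int. p (fst n))"
  obtain act :: "('v \<times> int) list \<Rightarrow> 'a" and nx Inv x where
    M: "machine (energy_arena (min Cap) wt E1) (energy_parity p) act nx Inv" and I: "Inv x (v0, e0)"
    using w1 unfolding wins_def by blast
  have nn: "0 \<le> snd n" if "Inv y n" for y n
    using energy_machine_nonneg[OF M, of y "fst n" "snd n"] that by simp
  have "machine (energy_arena id wt0 E2) (energy_parity p') act (\<lambda>x n. nx x (fst n))
      (\<lambda>x n. Inv x (fst n) \<and> snd (fst n) \<le> Cap \<and> snd n = 0)"
  proof (rule machineI)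
    fix y and n :: "('v \<times> int) \<times> int" assume a: "Inv y (fst n) \<and> snd (fst n) \<le> Cap \<and> snd n = 0"
    then obtain n' where "(fst n, act y, n') \<in> energy_arena (min Cap) wt E1" using machineD(1)[OF M] by blast
    then have "(fst n, act y, n') \<in> E2" using a nn[of y "fst n"] by (simp add: E2_def)
    then have "(n, act y, (n', 0)) \<in> energy_arena id wt0 E2" using a by (simp add: energy_arena_iff' wt0_def)
    then show "\<exists>n'. (n, act y, n') \<in> energy_arena id wt0 E2" by blast
  next
    fix y n n' assume a: "Inv y (fst n) \<and> snd (fst n) \<le> Cap \<and> snd n = 0"
      "(n, act y, n') \<in> energy_arena id wt0 E2"
    then have "(fst n, act y, fst n') \<in> energy_arena (min Cap) wt E1" "snd n' = 0"
      by (auto simp: energy_arena_iff' wt0_def E2_def)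
    then show "Inv (nx y (fst n')) (fst n') \<and> snd (fst n') \<le> Cap \<and> snd n' = 0"
      using machineD(2)[OF M, of y "fst n" "fst n'"] a(1) by (auto simp: energy_arena_iff')
  next
    fix \<xi> \<pi> assume a: "\<And>k. Inv (\<xi> k) (fst (\<pi> k)) \<and> snd (fst (\<pi> k)) \<le> Cap \<and> snd (\<pi> k) = 0"
      "\<And>k. (\<pi> k, act (\<xi> k), \<pi> (Suc k)) \<in> energy_arena id wt0 E2"
      "\<And>k. \<xi> (Suc k) = nx (\<xi> k) (fst (\<pi> (Suc k)))"
    have "energy_parity p (\<lambda>k. fst (\<pi> k))"
    proof (rule machineD(3)[OF M, of \<xi>])
      fix k
      show "Inv (\<xi> k) (fst (\<pi> k))" using a(1) by blast
      show "(fst (\<pi> k), act (\<xi> k), fst (\<pi> (Suc k))) \<in> energy_arena (min Cap) wt E1"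
        using a(2)[of k] by (simp add: energy_arena_iff'[of "\<pi> k"] E2_def)
      show "\<xi> (Suc k) = nx (\<xi> k) (fst (\<pi> (Suc k)))" by (rule a(3))
    qed
    then show "energy_parity p' \<pi>" using a(1) by (simp add: energy_parity_def parity_def p'_def)
  qed
  from machine_wins[OF this, of x "((v0, e0), 0)"] I e0
  have w2: "wins (energy_arena id wt0 E2) (energy_parity p') ((v0, e0), 0)" by simp
  define R where "R = {n. \<exists>c. wins (energy_arena id wt0 E2) (energy_parity p') (n, c)}"
  define E3 where "E3 = region R E2"
  note r3 = region_wins[OF R_def, folded E3_def]
  have sub3: "E3 \<subseteq> E2" by (auto simp: E3_def region_def)
  have full3: "(n, a, n'') \<in> E3" if "(n, a, n') \<in> E3" "(n, a, n'') \<in> E2" for n a n' n''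
    using that by (auto simp: E3_def region_def)
  have RS: "R \<subseteq> verts E1 \<times> {0..Cap}"
  proof
    fix n assume "n \<in> R"
    then have "n \<in> verts E2" using r3(1) sub3 by (auto simp: verts_def)
    then show "n \<in> verts E1 \<times> {0..Cap}"
      by (cases n) (auto simp: verts_iff E2_def energy_arena_iff)
  qed
  have "finite R" by (rule finite_subset[OF RS]) (use fin1 in simp)
  moreover have "all_win wt0 p' E3"
    unfolding all_win_def r3(1) using r3(3) unfolding R_def by blast
  ultimately obtain \<tau> where \<tau>: "positional p' E3 \<tau>"
    using positional_exists[of E3 wt0 p'] r3(1,2) by auto
  have av: "\<exists>n'. (n, \<tau> n, n') \<in> E3" if "n \<in> R" for n
    using \<tau> that r3(1) unfolding positional_def by metis
  \<comment> \<open>Both restrictions keep an action with all its successors, so following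
    \<open>\<tau>\<close> in the full arena never leaves \<open>E3\<close>.\<close>
  have step: "(n, \<tau> n, n') \<in> E3" if n: "n \<in> R" and e: "(n, \<tau> n, n') \<in> energy_arena (min Cap) wt E" for n n'
  proof -
    obtain m where m: "(n, \<tau> n, m) \<in> E3" using av[OF n] by blast
    then have m2: "(n, \<tau> n, m) \<in> E2" using sub3 by blast
    then have "(fst n, \<tau> n, fst n') \<in> E1"
      using full1[of "fst n" "\<tau> n" "fst m" "fst n'"] e by (simp add: E2_def energy_arena_iff')
    then have "(n, \<tau> n, n') \<in> E2" using m2 e by (simp add: E2_def energy_arena_iff')
    then show ?thesis using full3[OF m] by blast
  qed
  show ?thesis
  proof (rule that[of R e0 \<tau>])
    show "R \<subseteq> verts E \<times> {0..Cap}" using RS V1 by blast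
    show "(v0, e0) \<in> R" using w2 by (auto simp: R_def)
    show "\<exists>v'. (v, \<tau> (v, e), v') \<in> E" if "(v, e) \<in> R" for v e
      using av[OF that] sub1 sub3 by (force simp: E2_def energy_arena_iff')
    show "(v', min Cap (e + wt v (\<tau> (v, e)) v')) \<in> R" if "(v, e) \<in> R" "(v, \<tau> (v, e), v') \<in> E" for v e v'
      using step[OF that(1), of "(v', min Cap (e + wt v (\<tau> (v, e)) v'))"] that(2) r3(1,2)
      by (auto simp: energy_arena_iff closed_arena_def)
    show "\<forall>\<pi>. (\<forall>k. \<pi> k \<in> R \<and> (\<pi> k, \<tau> (\<pi> k), \<pi> (Suc k)) \<in> energy_arena (min Cap) wt E) \<longrightarrow>
      parity p (\<lambda>k. fst (\<pi> k))"
    proof (intro allI impI)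
      fix \<pi> assume "\<forall>k. \<pi> k \<in> R \<and> (\<pi> k, \<tau> (\<pi> k), \<pi> (Suc k)) \<in> energy_arena (min Cap) wt E"
      then have "\<forall>k. (\<pi> k, \<tau> (\<pi> k), \<pi> (Suc k)) \<in> E3" using step by blast
      then have "parity p' \<pi>" using \<tau> unfolding positional_def by blast
      then show "parity p (\<lambda>k. fst (\<pi> k))" by (simp add: parity_def p'_def)
    qed
  qed
qed

section \<open>Pumping words of a Moore machine\<close>

lemma lasso_index:
  assumes "k < (l :: nat)"
  obtains \<iota> :: "nat \<Rightarrow> nat" where "\<iota> 0 = 0"
    "\<And>t. \<iota> (Suc t) = Suc (\<iota> t) \<or> Suc (\<iota> t) = l \<and> \<iota> (Suc t) = k" "\<And>t. \<exists>s\<ge>t. \<iota> s = k"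
proof -
  \<comment> \<open>The indices run through 0, ..., l - 1 and then repeat k, ..., l - 1
    forever.\<close>
  define \<iota> where "\<iota> = rec_nat 0 (\<lambda>_ i. if Suc i = l then k else Suc i)"
  have S: "\<iota> (Suc t) = (if Suc (\<iota> t) = l then k else Suc (\<iota> t))" for t by (simp add: \<iota>_def)
  have lt: "\<iota> t < l" for t
    by (induction t) (use assms in \<open>auto simp: S, simp add: \<iota>_def\<close>)
  have "\<exists>s\<ge>t. \<iota> s = k" for t
  proof (induction "l - \<iota> t" arbitrary: t rule: less_induct)
    case less
    show ?case
    proof (cases "Suc (\<iota> t) = l")
      case True
      then show ?thesis by (intro exI[of _ "Suc t"]) (simp add: S)
    next
      case False
      then have "l - \<iota> (Suc t) < l - \<iota> t" using lt[of t] by (simp add: S)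
      then obtain s where "s \<ge> Suc t" "\<iota> s = k" using less by blast
      then show ?thesis using Suc_leD by blast
    qed
  qed
  then show ?thesis by (intro that[of \<iota>]) (auto simp: S, simp add: \<iota>_def)
qed

lemma moore_visits_bound:
  assumes M: "is_moore In Out M" and A: "is_automaton (In \<union> Out) A"
    and L: "moore_lang In M \<subseteq> L_ucb (In \<union> Out) A"
    and u: "u \<in> moore_lang In M" and r: "r \<in> runs A u"
  shows "finite {k. r k \<in> aut_final A}"
    and "card {k. r k \<in> aut_final A} \<le> card (aut_states A) * card (moore_states M)"
proof -
  let ?F = "{k. r k \<in> aut_final A}"
  show fin: "finite ?F" using u r L unfolding L_ucb_def by blast
  obtain i where i: "\<And>k. i k \<in> Pow In"
    and ui: "\<And>k. u k = moore_out M (foldl (moore_trans M) (moore_init M) (map i [0..<k])) \<union> i k"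
    using u unfolding moore_lang_def by blast
  define m where "m k = foldl (moore_trans M) (moore_init M) (map i [0..<k])" for k
  have m0: "m 0 = moore_init M" and mS: "m (Suc k) = moore_trans M (m k) (i k)" for k
    by (simp_all add: m_def)
  have um: "u k = moore_out M (m k) \<union> i k" for k using ui by (simp add: m_def)
  have mst: "m k \<in> moore_states M" for k
    by (induction k) (use M i in \<open>auto simp: m0 mS is_moore_def\<close>)
  have uP: "u k \<subseteq> In \<union> Out" for k using um[of k] M mst[of k] i[of k] by (auto simp: is_moore_def)
  have r0: "r 0 = aut_init A" and rS: "r (Suc k) \<in> aut_trans A (r k) (u k)" for k
    using r by (auto simp: runs_def)
  have rst: "r k \<in> aut_states A" for k
  proof (induction k)
    case (Suc k)
    then have "aut_trans A (r k) (u k) \<subseteq> aut_states A" using A uP[of k] by (simp add: is_automaton_def)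
    then show ?case using rS[of k] by blast
  qed (use A r0 in \<open>simp add: is_automaton_def\<close>)
  have "inj_on (\<lambda>k. (r k, m k)) ?F"
  proof (rule linorder_inj_onI)
    fix k l assume kl: "k < l" "k \<in> ?F" "l \<in> ?F"
    show "(r k, m k) \<noteq> (r l, m l)"
    proof
      assume eq: "(r k, m k) = (r l, m l)"
      obtain \<iota> where i0: "\<iota> 0 = 0"
        and iS: "\<And>t. \<iota> (Suc t) = Suc (\<iota> t) \<or> Suc (\<iota> t) = l \<and> \<iota> (Suc t) = k"
        and inf: "\<And>t. \<exists>s\<ge>t. \<iota> s = k"
        using that by (rule lasso_index[OF kl(1)])
      \<comment> \<open>Jumping back from \<open>l\<close> to \<open>k\<close> changes neither the
        automaton state nor the machine state. So the letters read along \<open>\<iota>\<close> form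
        a word of the machine, and \<open>r\<close> read along \<open>\<iota>\<close> is a run on it
        in which the final state \<open>r k\<close> recurs.\<close>
      have rS': "r (\<iota> (Suc t)) = r (Suc (\<iota> t))" and mS': "m (\<iota> (Suc t)) = m (Suc (\<iota> t))" for t
        using iS[of t] eq by auto
      have m': "foldl (moore_trans M) (moore_init M) (map (\<lambda>t. i (\<iota> t)) [0..<t]) = m (\<iota> t)" for t
        by (induction t) (simp_all add: i0 m0 mS' mS)
      have "(\<lambda>t. u (\<iota> t)) \<in> moore_lang In M"
        unfolding moore_lang_def mem_Collect_eq
        by (intro exI[of _ "\<lambda>t. i (\<iota> t)"] conjI allI i) (simp add: m' um)
      then have "\<forall>r'\<in>runs A (\<lambda>t. u (\<iota> t)). finite {k. r' k \<in> aut_final A}"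
        using L unfolding L_ucb_def by blast
      moreover have "(\<lambda>t. r (\<iota> t)) \<in> runs A (\<lambda>t. u (\<iota> t))"
        by (simp add: runs_def i0 r0 rS' rS)
      ultimately have "finite {t. r (\<iota> t) \<in> aut_final A}" by (rule bspec)
      moreover have "\<exists>s\<ge>t. r (\<iota> s) \<in> aut_final A" for t using inf[of t] kl(2) by auto
      ultimately show False
        by (metis (mono_tags, lifting) infinite_nat_iff_unbounded_le mem_Collect_eq)
    qed
  qed auto
  then have "card ?F \<le> card (aut_states A \<times> moore_states M)"
    using rst mst A M by (intro card_inj_on_le) (auto simp: is_automaton_def is_moore_def)
  then show "card ?F \<le> card (aut_states A) * card (moore_states M)"
    by (simp add: card_cartesian_product)
qed

section \<open>Realizability and Moore machines\<close>

lemma play_prefix_histories: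
  assumes "f \<in> strategies_O In Out" "g \<in> strategies_I In Out"
  shows "play_prefix f g k \<in> histories In Out"
proof (induction k)
  case (Suc k)
  then show ?case
    using assms by (auto simp: Let_def histories_def strategies_O_def strategies_I_def)
qed (simp add: histories_def)

lemma outcome_in_words:
  assumes "f \<in> strategies_O In Out" "g \<in> strategies_I In Out"
  shows "outcome f g \<in> words (In \<union> Out)"
  using play_prefix_histories[OF assms] assms
  by (fastforce simp: words_def outcome_def Let_def strategies_O_def strategies_I_def)

text \<open>The machine becomes a strategy by reading the inputs of the history. Boundedly many
  visits are finitely many, which gives \<open>\<phi>\<close>, and \<open>C\<close> serves as the
  initial credit.\<close>

lemma moore_realizes:
  assumes M: "is_moore In Out M" and L: "moore_lang In M \<subseteq> L_ucb_K In Out w K A C"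
    and A: "L_ucb (In \<union> Out) A = ltl_lang (In \<union> Out) \<phi>"
  shows "E_realizable In Out w \<phi>"
proof -
  define run where "run h = foldl (moore_trans M) (moore_init M) (map snd h)" for h :: "'a history"
  define f where "f h = moore_out M (run h)" for h :: "'a history"
  have "run h \<in> moore_states M" if "h \<in> histories In Out" for h
    using that
  proof (induction h rule: rev_induct)
    case Nil
    then show ?case using M by (simp add: run_def is_moore_def)
  next
    case (snoc x h)
    then have "run h \<in> moore_states M" "snd x \<in> Pow In" by (auto simp: histories_def)
    then show ?case using M by (simp add: run_def is_moore_def)
  qed
  then have f: "f \<in> strategies_O In Out"
    using M by (auto simp: strategies_O_def f_def is_moore_def)
  have "ltl_sat (outcome f g) \<phi> \<and> energy_ok w In Out C (outcome f g)" if g: "g \<in> strategies_I In Out" for g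
  proof -
    define i where "i k = g (play_prefix f g k) (f (play_prefix f g k))" for k
    have pre: "map snd (play_prefix f g k) = map i [0..<k]" for k
      by (induction k) (simp_all add: Let_def i_def)
    have out: "outcome f g k = moore_out M (foldl (moore_trans M) (moore_init M) (map i [0..<k])) \<union> i k" for k
    proof -
      have "f (play_prefix f g k) = moore_out M (foldl (moore_trans M) (moore_init M) (map i [0..<k]))"
        by (simp add: f_def run_def pre)
      then show ?thesis by (simp add: outcome_def Let_def i_def)
    qed
    have "i k \<in> Pow In" for k
      using g f play_prefix_histories[OF f g, of k]
      unfolding i_def strategies_I_def strategies_O_def by blast
    then have "outcome f g \<in> moore_lang In M"
      unfolding moore_lang_def mem_Collect_eq
      by (intro exI[of _ i]) (simp add: out)
    then have "outcome f g \<in> L_ucb_K In Out w K A C" using L by blast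
    moreover from this have "outcome f g \<in> L_ucb (In \<union> Out) A"
      by (auto simp: L_ucb_def L_ucb_K_def)
    ultimately show ?thesis unfolding A by (auto simp: ltl_lang_def L_ucb_K_def)
  qed
  with f show ?thesis unfolding E_realizable_def by blast
qed

section \<open>The game in rounds and its strategies\<close>

lemma letter_weight_split:
  assumes "In \<inter> Out = {}" "x \<subseteq> Out" "i \<subseteq> In"
  shows "letter_weight w In Out (x \<union> i) = set_weight w Out x + set_weight w In i"
proof -
  have "(x \<union> i) \<inter> Out = x" "(x \<union> i) \<inter> In = i" using assms by auto
  then show ?thesis by (simp add: letter_weight_def)
qed

text \<open>The game \<open>G\<^sub>\<phi>\<close> with two consecutive moves merged into one round: the vertices are its Player-1
  states and the actions are the output letters.\<close>

definition round_arena ::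
  "'a set \<Rightarrow> 'a set \<Rightarrow> ('q, 'a) dpa \<Rightarrow> ('q \<times> 'a set) set \<Rightarrow>
   (('q \<times> 'a set) \<times> 'a set \<times> ('q \<times> 'a set)) set" where
  "round_arena In Out D X =
     {((q, j), x, (dpa_trans D q (x \<union> i), i)) | q j x i. (q, j) \<in> X \<and> x \<in> Pow Out \<and> i \<in> Pow In}"

definition round_weight ::
  "'a set \<Rightarrow> 'a set \<Rightarrow> ('a literal \<Rightarrow> int) \<Rightarrow> 'q \<times> 'a set \<Rightarrow> 'a set \<Rightarrow> 'q \<times> 'a set \<Rightarrow> int" where
  "round_weight In Out w v x v' = set_weight w Out x + set_weight w In (snd v')"

lemma round_arena_iff:
  "(v, x, v') \<in> round_arena In Out D X \<longleftrightarrow>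
     v \<in> X \<and> x \<in> Pow Out \<and> snd v' \<in> Pow In \<and> fst v' = dpa_trans D (fst v) (x \<union> snd v')"
  by (cases v; cases v') (auto simp: round_arena_def)

lemma verts_round_arena: "verts (round_arena In Out D X) = X"
proof (intro set_eqI iffI)
  fix v assume v: "v \<in> X"
  have "(v, {}, (dpa_trans D (fst v) {}, {})) \<in> round_arena In Out D X"
    using v by (simp add: round_arena_iff)
  then show "v \<in> verts (round_arena In Out D X)" unfolding verts_iff by blast
qed (auto simp: verts_iff round_arena_iff simp del: split_paired_Ex)

lemma dpa_run_in_states:
  assumes "is_dpa P D" "u \<in> words P"
  shows "dpa_run D u k \<in> dpa_states D"
  using assms by (induction k) (auto simp: is_dpa_def words_def)

lemma dpa_lang_iff_parity:
  assumes D: "is_dpa P D" and u: "u \<in> words P"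
  shows "u \<in> dpa_lang P D \<longleftrightarrow> parity (dpa_prio D) (dpa_run D u)"
proof -
  have "finite (range (\<lambda>k. dpa_prio D (dpa_run D u k)))"
    by (rule finite_subset[of _ "dpa_prio D ` dpa_states D"])
      (use D dpa_run_in_states[OF D u] in \<open>auto simp: is_dpa_def\<close>)
  from parity_iff_even_Min[of "dpa_prio D" "dpa_run D u", OF this] u show ?thesis
    by (simp add: dpa_lang_def)
qed

text \<open>The history itself is the memory: automaton state and energy are functions of it, and
  \<open>Inv\<close> ties both to the node and makes the history consistent with
  \<open>f\<close>.\<close>

lemma realizable_wins:
  fixes D :: "('q, 'a) dpa"
  assumes dis: "In \<inter> Out = {}" and D: "is_dpa (In \<union> Out) D"
    and lang: "dpa_lang (In \<union> Out) D = ltl_lang (In \<union> Out) \<phi>"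
    and real: "E_realizable In Out w \<phi>"
    and X: "\<And>q j. (q, j) \<in> X \<Longrightarrow> j \<in> Pow In" "(dpa_init D, j0) \<in> X"
      "\<And>v x v'. (v, x, v') \<in> round_arena In Out D X \<Longrightarrow> v' \<in> X"
  shows "\<exists>c. wins (energy_arena id (round_weight In Out w) (round_arena In Out D X))
    (energy_parity (\<lambda>v. dpa_prio D (fst v))) ((dpa_init D, j0), c)"
proof -
  let ?E = "energy_arena id (round_weight In Out w) (round_arena In Out D X)"
  obtain f c0 where f: "f \<in> strategies_O In Out"
    and win: "\<And>g. g \<in> strategies_I In Out \<Longrightarrow>
        ltl_sat (outcome f g) \<phi> \<and> energy_ok w In Out c0 (outcome f g)"
    using real unfolding E_realizable_def by blast
  define state where "state = foldl (\<lambda>q (x, i). dpa_trans D q (x \<union> i)) (dpa_init D)"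
  define en where "en h = int c0 + (\<Sum>(x, i)\<leftarrow>h. letter_weight w In Out (x \<union> i))" for h :: "'a history"
  have state: "state [] = dpa_init D" "state (h @ [(x, i)]) = dpa_trans D (state h) (x \<union> i)" for h x i
    by (simp_all add: state_def)
  have en: "en [] = int c0" "en (h @ [(x, i)]) = en h + letter_weight w In Out (x \<union> i)" for h x i
    by (simp_all add: en_def)
  define nx where "nx h n = h @ [(f h, snd (fst n))]" for h and n :: "('q \<times> 'a set) \<times> int"
  define Inv where "Inv h n \<longleftrightarrow> h \<in> histories In Out \<and> (\<forall>k<length h. fst (h ! k) = f (take k h)) \<and>
      fst n \<in> X \<and> fst (fst n) = state h \<and> snd n = en h" for h n
  have fO: "f h \<in> Pow Out" if "h \<in> histories In Out" for h using f that by (simp add: strategies_O_def)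
  have "machine ?E (energy_parity (\<lambda>v. dpa_prio D (fst v))) f nx Inv"
  proof (rule machineI)
    fix h n assume "Inv h n"
    then have "(n, f h, ((dpa_trans D (fst (fst n)) (f h), {}),
        snd n + round_weight In Out w (fst n) (f h) (dpa_trans D (fst (fst n)) (f h), {}))) \<in> ?E"
      using fO[of h] by (simp add: Inv_def energy_arena_iff' round_arena_iff)
    then show "\<exists>n'. (n, f h, n') \<in> ?E" by blast
  next
    fix h n n' assume I: "Inv h n" and e: "(n, f h, n') \<in> ?E"
    have e': "(fst n, f h, fst n') \<in> round_arena In Out D X"
      "snd n' = snd n + round_weight In Out w (fst n) (f h) (fst n')"
      using e by (auto simp: energy_arena_iff')
    have i: "snd (fst n') \<in> Pow In" "fst (fst n') = dpa_trans D (fst (fst n)) (f h \<union> snd (fst n'))"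
      "f h \<in> Pow Out"
      using e'(1) by (auto simp: round_arena_iff)
    have "fst n' \<in> X" using X(3) e'(1) by blast
    moreover have "snd n' = en (nx h n')"
      using e'(2) I i letter_weight_split[OF dis, of "f h" "snd (fst n')" w]
      by (simp add: nx_def en round_weight_def Inv_def)
    moreover have "nx h n' \<in> histories In Out" using I i by (auto simp: Inv_def nx_def histories_def)
    moreover have "fst (nx h n' ! k) = f (take k (nx h n'))" if "k < length (nx h n')" for k
      using I that by (cases "k = length h") (auto simp: Inv_def nx_def nth_append)
    ultimately show "Inv (nx h n') n'"
      using I i(2) by (simp add: Inv_def) (simp add: nx_def state)
  next
    fix \<xi> \<pi> assume I: "\<And>k. Inv (\<xi> k) (\<pi> k)" and e: "\<And>k. (\<pi> k, f (\<xi> k), \<pi> (Suc k)) \<in> ?E"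
      and n: "\<And>k. \<xi> (Suc k) = nx (\<xi> k) (\<pi> (Suc k))"
    define m where "m = length (\<xi> 0)"
    \<comment> \<open>A path may begin after any history consistent with \<open>f\<close>, so
      \<open>g\<close> first replays the inputs of \<open>\<xi> 0\<close>. Afterwards round
      \<open>m + k\<close> uses the input stored in \<open>\<pi> (Suc k)\<close>, whence the index
      \<open>Suc (length h) - m\<close>.\<close>
    define g :: "'a history \<Rightarrow> 'a set \<Rightarrow> 'a set" where
      "g h x = (if length h < m then snd (\<xi> 0 ! length h) else snd (fst (\<pi> (Suc (length h) - m))))" for h x
    have "g h x \<in> Pow In" for h x
    proof (cases "length h < m")
      case True
      then have "\<xi> 0 ! length h \<in> set (\<xi> 0)" by (simp add: m_def)
      then have "\<xi> 0 ! length h \<in> Pow Out \<times> Pow In" using I[of 0] unfolding Inv_def histories_def by blast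
      then show ?thesis using True by (simp add: g_def mem_Times_iff)
    next
      case False
      have "fst (\<pi> (Suc (length h) - m)) \<in> X" using I by (simp add: Inv_def)
      then show ?thesis using X(1) False by (cases "fst (\<pi> (Suc (length h) - m))") (auto simp: g_def)
    qed
    then have g: "g \<in> strategies_I In Out" by (simp add: strategies_I_def)
    let ?u = "outcome f g"
    have run: "dpa_run D ?u k = state (play_prefix f g k)" for k
      by (induction k) (simp_all add: state Let_def outcome_def)
    have sum: "int c0 + (\<Sum>k<j. letter_weight w In Out (?u k)) = en (play_prefix f g j)" for j
      by (induction j) (simp_all add: en Let_def outcome_def)
    have pre: "play_prefix f g k = take k (\<xi> 0)" if "k \<le> m" for k
      using that
    proof (induction k)
      case (Suc k)
      then have "fst (\<xi> 0 ! k) = f (take k (\<xi> 0))" using I[of 0] by (simp add: Inv_def m_def)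
      then have "\<xi> 0 ! k = (f (take k (\<xi> 0)), snd (\<xi> 0 ! k))" by (metis prod.collapse)
      then show ?case using Suc by (simp add: Let_def g_def m_def take_Suc_conv_app_nth)
    qed simp
    have len: "length (\<xi> k) = m + k" for k by (induction k) (simp_all add: m_def n nx_def)
    have pl: "play_prefix f g (m + k) = \<xi> k" for k
    proof (induction k)
      case 0
      then show ?case using pre[of m] by (simp add: m_def)
    next
      case (Suc k)
      then show ?case by (simp add: Let_def n nx_def g_def len)
    qed
    have "?u \<in> dpa_lang (In \<union> Out) D"
      unfolding lang ltl_lang_def using win[OF g] outcome_in_words[OF f g] by simp
    then have "parity (dpa_prio D) (dpa_run D ?u)"
      using dpa_lang_iff_parity[OF D outcome_in_words[OF f g]] by simp
    then have "parity (dpa_prio D) (\<lambda>k. dpa_run D ?u (m + k))" by (simp only: parity_suffix_iff)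
    moreover have "dpa_run D ?u (m + k) = fst (fst (\<pi> k))" for k
      using I[of k] by (simp add: run pl Inv_def)
    ultimately have "parity (\<lambda>v. dpa_prio D (fst v)) (\<lambda>k. fst (\<pi> k))" by (simp add: parity_def)
    moreover have "0 \<le> snd (\<pi> k)" for k
      using I[of k] win[OF g] sum[of "m + k"] unfolding energy_ok_def Inv_def by (metis pl)
    ultimately show "energy_parity (\<lambda>v. dpa_prio D (fst v)) \<pi>" by (simp add: energy_parity_def)
  qed
  moreover have "Inv [] ((dpa_init D, j0), int c0)"
    using X(2) by (simp add: Inv_def histories_def state en)
  ultimately have "wins ?E (energy_parity (\<lambda>v. dpa_prio D (fst v))) ((dpa_init D, j0), int c0)"
    by (rule machine_wins)
  then show ?thesis by blast
qed

text \<open>The factor 4 is the 2 of \<open>bounded_positional\<close> times the two moves of a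
  round. The range \<open>{0..Cap}\<close> has \<open>Cap + 1\<close> values, hence the size
  bound.\<close>

lemma moore_of_winning:
  fixes D :: "('q, 'a) dpa" and W Cap :: nat
  assumes dis: "In \<inter> Out = {}" and D: "is_dpa (In \<union> Out) D"
    and fin: "finite X"
    and W: "1 \<le> W" "\<And>x. x \<in> Pow Out \<Longrightarrow> \<bar>set_weight w Out x\<bar> \<le> int W"
      "\<And>i. i \<in> Pow In \<Longrightarrow> \<bar>set_weight w In i\<bar> \<le> int W"
    and win: "wins (energy_arena id (round_weight In Out w) (round_arena In Out D X))
      (energy_parity (\<lambda>v. dpa_prio D (fst v))) ((dpa_init D, j0), c0)"
    and Cap: "4 * card X * card ((\<lambda>v. dpa_prio D (fst v)) ` X) * W \<le> Cap"
  obtains M :: "(nat, 'a) moore" where "is_moore In Out M" "card (moore_states M) \<le> card X * (Cap + 1)"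
    "moore_lang In M \<subseteq> dpa_lang (In \<union> Out) D" "\<And>u. u \<in> moore_lang In M \<Longrightarrow> energy_ok w In Out Cap u"
proof -
  let ?E = "round_arena In Out D X" and ?wt = "round_weight In Out w" and ?p = "\<lambda>v. dpa_prio D (fst v)"
  have bd: "\<bar>?wt v x v'\<bar> \<le> 2 * int W" if "(v, x, v') \<in> ?E" for v x v'
    using W(2)[of x] W(3)[of "snd v'"] that by (simp add: round_weight_def round_arena_iff)
  have finV: "finite (verts ?E)" using fin by (simp add: verts_round_arena)
  have B: "1 \<le> 2 * int W" using W(1) by simp
  have CapV: "2 * int (card (verts ?E)) * int (card (?p ` verts ?E)) * (2 * int W) \<le> int Cap"
    using of_nat_mono[OF Cap, where 'a = int] by (simp add: algebra_simps verts_round_arena)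
  obtain R \<tau> e0 where R: "R \<subseteq> X \<times> {0..int Cap}" "((dpa_init D, j0), e0) \<in> R"
    "\<And>v e. (v, e) \<in> R \<Longrightarrow> \<exists>v'. (v, \<tau> (v, e), v') \<in> ?E"
    "\<And>v e v'. (v, e) \<in> R \<Longrightarrow> (v, \<tau> (v, e), v') \<in> ?E \<Longrightarrow> (v', min (int Cap) (e + ?wt v (\<tau> (v, e)) v')) \<in> R"
    "\<forall>\<pi>. (\<forall>k. \<pi> k \<in> R \<and> (\<pi> k, \<tau> (\<pi> k), \<pi> (Suc k)) \<in> energy_arena (min (int Cap)) ?wt ?E) \<longrightarrow>
      parity ?p (\<lambda>k. fst (\<pi> k))"
    using bd CapV[unfolded verts_round_arena] that
    by (rule bounded_positional[OF finV win B, unfolded verts_round_arena])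
  have finR: "finite R" by (rule finite_subset[OF R(1)]) (use fin in simp)
  \<comment> \<open>The nodes in \<open>R\<close> are numbered because the machine is to have states
    of type \<open>nat\<close>.\<close>
  obtain b where b: "bij_betw b R {0..<card R}" using ex_bij_betw_finite_nat[OF finR] by blast
  define c where "c = inv_into R b"
  have cb: "c (b n) = n" if "n \<in> R" for n
    using b that by (simp add: c_def bij_betw_inv_into_left)
  have cR: "c s \<in> R" if "s < card R" for s
    using bij_betwE[OF bij_betw_inv_into[OF b]] that by (simp add: c_def)
  have bR: "b n < card R" if "n \<in> R" for n using bij_betwE[OF b] that by simp
  define step where "step n i = (let v' = (dpa_trans D (fst (fst n)) (\<tau> n \<union> i), i)
      in (v', min (int Cap) (snd n + ?wt (fst n) (\<tau> n) v')))" for n :: "('q \<times> 'a set) \<times> int" and i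
  have \<tau>O: "\<tau> n \<in> Pow Out" if "n \<in> R" for n
    using R(3)[of "fst n" "snd n"] that by (auto simp: round_arena_iff simp del: split_paired_Ex)
  have stepE: "(n, \<tau> n, step n i) \<in> energy_arena (min (int Cap)) ?wt ?E" if "n \<in> R" "i \<in> Pow In" for n i
  proof -
    have "fst n \<in> X" using R(1) that(1) by auto
    then show ?thesis using \<tau>O[OF that(1)] that(2)
      by (simp add: energy_arena_iff' round_arena_iff step_def Let_def)
  qed
  have stepR: "step n i \<in> R" if "n \<in> R" "i \<in> Pow In" for n i
    using R(4)[of "fst n" "snd n" "fst (step n i)"] stepE[OF that] that(1)
    by (simp add: energy_arena_iff' step_def Let_def)
  define M :: "(nat, 'a) moore" where
    "M = \<lparr>moore_states = {0..<card R}, moore_init = b ((dpa_init D, j0), e0),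
      moore_trans = (\<lambda>s i. b (step (c s) i)), moore_out = (\<lambda>s. \<tau> (c s))\<rparr>"
  have moore: "is_moore In Out M"
    using R(2) bR stepR cR \<tau>O by (simp add: is_moore_def M_def)
  have "card R \<le> card (X \<times> {0..int Cap})" using R(1) fin by (intro card_mono) auto
  then have size: "card (moore_states M) \<le> card X * (Cap + 1)"
    by (simp add: M_def card_cartesian_product nat_add_distrib)
  have both: "u \<in> dpa_lang (In \<union> Out) D \<and> energy_ok w In Out Cap u" if u: "u \<in> moore_lang In M" for u
  proof -
    obtain i where i: "\<And>k. i k \<in> Pow In"
      and ui: "\<And>k. u k = moore_out M (foldl (moore_trans M) (moore_init M) (map i [0..<k])) \<union> i k"
      using u unfolding moore_lang_def by blast
    define \<pi> where "\<pi> k = foldl step ((dpa_init D, j0), e0) (map i [0..<k])" for k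
    have \<pi>0: "\<pi> 0 = ((dpa_init D, j0), e0)" and \<pi>S: "\<pi> (Suc k) = step (\<pi> k) (i k)" for k
      by (simp_all add: \<pi>_def)
    have \<pi>R: "\<pi> k \<in> R" for k by (induction k) (simp_all add: \<pi>0 \<pi>S R(2) stepR[OF _ i])
    have "foldl (moore_trans M) (moore_init M) (map i [0..<k]) = b (\<pi> k)" for k
    proof (induction k)
      case (Suc k)
      then show ?case by (simp add: \<pi>S) (simp add: M_def cb \<pi>R)
    qed (simp add: M_def \<pi>0)
    then have uk: "u k = \<tau> (\<pi> k) \<union> i k" for k by (simp add: ui) (simp add: M_def cb \<pi>R)
    have "u k \<subseteq> In \<union> Out" for k using uk[of k] \<tau>O[OF \<pi>R, of k] i[of k] by auto
    then have uw: "u \<in> words (In \<union> Out)" by (simp add: words_def)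
    have run: "dpa_run D u k = fst (fst (\<pi> k))" for k
      by (induction k) (simp_all add: \<pi>0 \<pi>S uk step_def Let_def)
    have "parity ?p (\<lambda>k. fst (\<pi> k))" using R(5) by (simp add: \<pi>R \<pi>S stepE[OF \<pi>R i])
    then have "parity (dpa_prio D) (dpa_run D u)" by (simp add: parity_def run)
    then have "u \<in> dpa_lang (In \<union> Out) D" using dpa_lang_iff_parity[OF D uw] by simp
    moreover have lw: "letter_weight w In Out (u k) = ?wt (fst (\<pi> k)) (\<tau> (\<pi> k)) (fst (\<pi> (Suc k)))" for k
      using letter_weight_split[OF dis, of "\<tau> (\<pi> k)" "i k"] \<tau>O[OF \<pi>R, of k] i[of k]
      by (simp add: uk \<pi>S round_weight_def step_def Let_def)
    \<comment> \<open>\<open>min\<close> only lowers the energy, and the play starts with at most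
      \<open>Cap\<close>. So the stored energy, which is never negative, bounds \<open>Cap\<close>
      plus the true sum from below.\<close>
    have "snd (\<pi> k) \<le> int Cap + (\<Sum>j<k. letter_weight w In Out (u j))" for k
    proof (induction k)
      case 0
      then show ?case using R(1,2) by (auto simp: \<pi>0)
    next
      case (Suc k)
      have "snd (\<pi> (Suc k)) \<le> snd (\<pi> k) + letter_weight w In Out (u k)"
        unfolding lw by (simp add: \<pi>S step_def Let_def)
      then show ?case using Suc by simp
    qed
    moreover have "0 \<le> snd (\<pi> k)" for k using \<pi>R[of k] R(1) by auto
    ultimately show ?thesis unfolding energy_ok_def using order_trans by blast
  qed
  show ?thesis using that[OF moore size] both by blast
qed

theorem theorem9:
  fixes In Out :: "'a set"
    and \<phi> :: "'a ltl"
    and w :: "'a literal \<Rightarrow> int"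
    and D :: "('q, 'a) dpa"
    and j0 :: "'a set"
    and G :: "('q, 'a) gstate energy_parity_game"
    and A :: "('s, 'a) automaton"
    and n d W K C :: nat
  assumes "finite In" and "finite Out" and "In \<inter> Out = {}"
    and "atoms \<phi> \<subseteq> In \<union> Out"
    and "is_dpa (In \<union> Out) D" and "dpa_lang (In \<union> Out) D = ltl_lang (In \<union> Out) \<phi>"
    and "j0 \<in> Pow In"
    and "G = game_of In Out w D j0"
    and "d = num_priorities G"
    and "W = max_weight G" and "W \<ge> 1"
    and "is_automaton (In \<union> Out) A" and "L_ucb (In \<union> Out) A = ltl_lang (In \<union> Out) \<phi>"
    and "n = card (aut_states A)"
    and "K = 4 * n * (card (game_states G))\<^sup>2 * d * W"
    and "C = K * W"
  shows "E_realizable In Out w \<phi> \<longleftrightarrow>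
    (\<exists>M :: (nat, 'a) moore. is_moore In Out M \<and> moore_lang In M \<subseteq> L_ucb_K In Out w K A C)"
proof
  assume "\<exists>M :: (nat, 'a) moore. is_moore In Out M \<and> moore_lang In M \<subseteq> L_ucb_K In Out w K A C"
  then show "E_realizable In Out w \<phi>" using moore_realizes assms(13) by metis
next
  assume real: "E_realizable In Out w \<phi>"
  let ?reach = "reachable_states In Out D j0" and ?F = "full_edges In Out D"
  let ?q = "dpa_init D" and ?p = "\<lambda>v :: 'q \<times> 'a set. dpa_prio D (fst v)"
  have finQ: "finite (dpa_states D)" and q: "?q \<in> dpa_states D"
    and tr: "\<And>q s. q \<in> dpa_states D \<Longrightarrow> s \<in> Pow (In \<union> Out) \<Longrightarrow> dpa_trans D q s \<in> dpa_states D"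
    using assms(5) by (auto simp: is_dpa_def)
  have succ: "t \<in> ?reach" if "s \<in> ?reach" "(s, t) \<in> ?F" for s t
    using that by (auto simp: reachable_states_def intro: rtrancl_into_rtrancl)
  have init: "St1 ?q j0 \<in> ?reach" by (simp add: reachable_states_def)
  have F1: "(St1 q j, St2 q x) \<in> ?F" if "q \<in> dpa_states D" "j \<in> Pow In" "x \<in> Pow Out" for q j x
    using that by (auto simp: full_edges_def)
  have F2: "(St2 q x, St1 (dpa_trans D q (x \<union> i)) i) \<in> ?F"
    if "q \<in> dpa_states D" "x \<in> Pow Out" "i \<in> Pow In" for q x i
    using that by (auto simp: full_edges_def)
  define X where "X = {(q, j). St1 q j \<in> player1 G}"
  have X: "(q, j) \<in> X \<longleftrightarrow> q \<in> dpa_states D \<and> j \<in> Pow In \<and> St1 q j \<in> ?reach" for q j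
    by (auto simp: X_def assms(8) game_of_def)
  have XIn: "j \<in> Pow In" if "(q, j) \<in> X" for q j using X that by simp
  have X0: "(?q, j0) \<in> X" using X q assms(7) init by blast
  have Xcl: "v' \<in> X" if "(v, x, v') \<in> round_arena In Out D X" for v x v'
  proof -
    obtain q j q' i where v: "v = (q, j)" "v' = (q', i)" by (cases v; cases v')
    have a: "(q, j) \<in> X" "x \<in> Pow Out" "i \<in> Pow In" "q' = dpa_trans D q (x \<union> i)"
      using that by (auto simp: v round_arena_iff)
    then have r: "q \<in> dpa_states D" "j \<in> Pow In" "St1 q j \<in> ?reach" using X by auto
    have "St2 q x \<in> ?reach" using succ[OF r(3) F1[OF r(1,2) a(2)]] .
    then have "St1 q' i \<in> ?reach" using succ[OF _ F2[OF r(1) a(2,3)]] a(4) by simp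
    moreover have "q' \<in> dpa_states D" using tr[OF r(1), of "x \<union> i"] a by auto
    ultimately show ?thesis using X a(3) v by simp
  qed
  have finX: "finite X"
    by (rule finite_subset[of _ "dpa_states D \<times> Pow In"]) (use X finQ assms(1) in auto)
  have finF: "finite ?F"
  proof (rule finite_subset)
    define S where "S = (\<lambda>(q, j). St1 q j) ` (dpa_states D \<times> Pow In) \<union> (\<lambda>(q, x). St2 q x) ` (dpa_states D \<times> Pow Out)"
    have s1: "St1 q j \<in> S" if "q \<in> dpa_states D" "j \<in> Pow In" for q j
      unfolding S_def using that by (intro UnI1) force
    have s2: "St2 q x \<in> S" if "q \<in> dpa_states D" "x \<in> Pow Out" for q x
      unfolding S_def using that by (intro UnI2) force
    have s3: "dpa_trans D q (x \<union> i) \<in> dpa_states D"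
      if "q \<in> dpa_states D" "x \<in> Pow Out" "i \<in> Pow In" for q x i
      using tr[OF that(1), of "x \<union> i"] that by auto
    show "?F \<subseteq> S \<times> S"
      by (auto simp: full_edges_def intro!: s1 s2 s3)
    show "finite (S \<times> S)" using finQ assms(1,2) by (simp add: S_def)
  qed
  have finE: "finite (edges G)" using finF by (simp add: assms(8) game_of_def)
  have wE: "\<bar>gstate_weight In Out w t\<bar> \<le> int W" if "s \<in> ?reach" "(s, t) \<in> ?F" for s t
  proof -
    have "(s, t) \<in> edges G" using that succ[OF that] by (simp add: assms(8) game_of_def)
    then have "nat \<bar>weight G (s, t)\<bar> \<le> W"
      unfolding assms(10) max_weight_def using finE by (intro Max_ge) auto
    then show ?thesis by (simp add: assms(8) game_of_def)
  qed
  \<comment> \<open>Every output letter occurs on an edge leaving the initial state, and every input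
    letter on an edge leaving its successor \<open>St2 ?q {}\<close>, so \<open>W\<close> bounds the
    weights of all letters.\<close>
  have W1: "\<bar>set_weight w Out x\<bar> \<le> int W" if "x \<in> Pow Out" for x
    using wE[OF init F1[OF q assms(7) that]] by simp
  have r2: "St2 ?q {} \<in> ?reach" using succ[OF init F1[OF q assms(7)]] by simp
  have W2: "\<bar>set_weight w In i\<bar> \<le> int W" if "i \<in> Pow In" for i
    using wE[OF r2 F2[OF q _ that]] by simp
  let ?S = "game_states G"
  have finP: "finite (player1 G)" "finite (player2 G)"
    by (rule finite_subset[of _ "(\<lambda>(q, j). St1 q j) ` (dpa_states D \<times> Pow In)"],
        force simp: assms(8) game_of_def, use finQ assms(1) in simp,
        rule finite_subset[of _ "(\<lambda>(q, j). St2 q j) ` (dpa_states D \<times> Pow Out)"],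
        force simp: assms(8) game_of_def, use finQ assms(2) in simp)
  then have finS: "finite ?S" by (simp add: game_states_def)
  define N where "N = card X"
  \<comment> \<open>The game also has a Player-2 state; counting it lets \<open>N (N + 1)\<close>
    fit into the square of the number of states.\<close>
  have NS: "N + 1 \<le> card ?S"
  proof -
    let ?Y = "insert (St2 ?q {}) ((\<lambda>(q, j). St1 q j) ` X)"
    have "inj_on (\<lambda>(q, j). St1 q j) X" by (auto simp: inj_on_def)
    then have "card ((\<lambda>(q, j). St1 q j) ` X) = N" by (simp add: N_def card_image)
    moreover have "St2 ?q {} \<notin> (\<lambda>(q, j). St1 q j) ` X" by auto
    ultimately have "card ?Y = N + 1" using finX by simp
    moreover have "?Y \<subseteq> ?S"
      using r2 q by (auto simp: X_def game_states_def assms(8) game_of_def)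
    ultimately show ?thesis using card_mono[OF finS] by metis
  qed
  have N1: "1 \<le> N" using X0 finX by (auto simp: N_def Suc_le_eq card_gt_0_iff)
  have dX: "card (?p ` X) \<le> d"
    unfolding assms(9) num_priorities_def
  proof (rule card_mono)
    show "?p ` X \<subseteq> prio G ` ?S"
    proof
      fix c assume "c \<in> ?p ` X"
      then obtain q j where v: "(q, j) \<in> X" "c = dpa_prio D q" by auto
      then have "St1 q j \<in> ?S" "prio G (St1 q j) = c"
        by (auto simp: X_def game_states_def assms(8) game_of_def)
      then show "c \<in> prio G ` ?S" by blast
    qed
  qed (use finS in simp)
  have "0 < card (?p ` X)" using X0 finX by (auto simp: card_gt_0_iff)
  then have d1: "1 \<le> d" using dX by simp
  have "finite (aut_states A)" "aut_states A \<noteq> {}" using assms(12) unfolding is_automaton_def by blast+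
  then have n1: "1 \<le> n" unfolding assms(14) by (simp add: Suc_le_eq card_gt_0_iff)
  obtain c0 where win: "wins (energy_arena id (round_weight In Out w) (round_arena In Out D X))
      (energy_parity ?p) ((?q, j0), c0)"
    using realizable_wins[OF assms(3,5,6) real, of X j0] XIn X0 Xcl by (metis (no_types, lifting))
  let ?Cap = "4 * N * d * W"
  have CapX: "4 * card X * card (?p ` X) * W \<le> ?Cap" using dX by (simp add: N_def)
  obtain M :: "(nat, 'a) moore" where M: "is_moore In Out M"
    and sz: "card (moore_states M) \<le> card X * (?Cap + 1)"
    and lang: "moore_lang In M \<subseteq> dpa_lang (In \<union> Out) D"
    and en: "\<And>u. u \<in> moore_lang In M \<Longrightarrow> energy_ok w In Out ?Cap u"
    using W1 W2 win CapX that by (rule moore_of_winning[OF assms(3,5) finX assms(11)])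
  have dW: "1 \<le> d * W" using d1 assms(11) by simp
  have "card (moore_states M) \<le> N * (?Cap + 1)" using sz by (simp add: N_def)
  \<comment> \<open>Enlarging \<open>1\<close> to \<open>4 d W\<close> makes the bound factor as
    \<open>4 N (N + 1) d W\<close>.\<close>
  also have "\<dots> \<le> N * (?Cap + 4 * (d * W))" using dW by (intro mult_left_mono) linarith+
  also have "\<dots> = 4 * (N * (N + 1)) * (d * W)" by (simp add: algebra_simps)
  also have "\<dots> \<le> 4 * (card ?S)\<^sup>2 * (d * W)"
    unfolding power2_eq_square using NS by (intro mult_mono) auto
  finally have "n * card (moore_states M) \<le> n * (4 * (card ?S)\<^sup>2 * (d * W))" by (rule mult_left_mono) simp
  then have nK: "n * card (moore_states M) \<le> K" by (simp add: assms(15) algebra_simps)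
  \<comment> \<open>The credit \<open>?Cap\<close> lies below \<open>C\<close>, whose additional
    factors \<open>n\<close> and \<open>W\<close> are at least 1.\<close>
  have "N * 1 \<le> (card ?S)\<^sup>2" unfolding power2_eq_square using NS by (intro mult_mono) auto
  then have "4 * N * d * W * 1 * 1 \<le> 4 * (card ?S)\<^sup>2 * d * W * n * W"
    using n1 assms(11) by (intro mult_mono) auto
  then have CC: "?Cap \<le> C" by (simp add: assms(15,16) algebra_simps)
  have ucb: "moore_lang In M \<subseteq> L_ucb (In \<union> Out) A" using lang assms(6,13) by simp
  have "moore_lang In M \<subseteq> L_ucb_K In Out w K A C"
  proof
    fix u assume u: "u \<in> moore_lang In M"
    have "finite {k. r k \<in> aut_final A} \<and> card {k. r k \<in> aut_final A} \<le> K" if "r \<in> runs A u" for r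
      using moore_visits_bound[OF M assms(12) ucb u that] nK assms(14) by simp
    moreover have "energy_ok w In Out C u"
      using en[OF u] CC unfolding energy_ok_def by (smt (verit) of_nat_mono)
    moreover have "u \<in> words (In \<union> Out)" using u ucb by (auto simp: L_ucb_def)
    ultimately show "u \<in> L_ucb_K In Out w K A C" by (simp add: L_ucb_K_def)
  qed
  with M show "\<exists>M :: (nat, 'a) moore. is_moore In Out M \<and> moore_lang In M \<subseteq> L_ucb_K In Out w K A C"
    by blast
qed

end
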